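(* Let $\varphi^{ij}(u,v)\in\mathbb R[[u,v]]$, $i,j=1,\dots,n$, be any solution of the classical Yang--Baxter equation (CYBE) for $W_n$, and let the group $FDiff(\mathbb R^n)$ be equipped with the Poisson structure $$\Omega^{ij}(j^\infty_uX,j^\infty_vX)=\sum_{k,l=1}^n\left(X_{*u}\right)^i_k\left(X_{*v}\right)^j_l\varphi^{kl}(u,v)-\varphi^{ij}(X(u),X(v)).$$ Then the action of $FDiff(\mathbb R^n)$ on $\mathbb R^n$ by $u\mapsto X(u)$ induces a Poisson structure on $\mathbb R^n$ given by $\alpha^{ij}(u)=-\varphi^{ij}(u,u)$; that is, $\alpha^{ij}$ is a Poisson bivector field on $\mathbb R^n$ and it is compatible with the action, i.e. $$\alpha^{ij}(X(u))=\Omega^{ij}(j^{\infty}_{u}X,j^{\infty}_{u}X)+\sum_{k,l=1}^n\left(X_{*u}\right)^i_k\left(X_{*u}\right)^j_l\alpha^{kl}(u),\qquad i,j=1,\dots,n .$$ In particular, if $\varphi^{ij}(u,v)=\sum_{k,l=1}^{n}\left(F_{*u}^{-1}\right)^{i}_{k}\left(F_{*v}^{-1}\right)^{j}_{l}\left[F^{k}(u)-F^{l}(v)\right]$ for formal Laurent series $F^1,\dots,F^n\in\mathbb R((u^1,\dots,u^n))$ with invertible Jacobian matrix $F_{*u}=(\partial F^i/\partial u^j)$, then $$\alpha^{ij}(u)=-\varphi^{ij}(u,u)=-\sum_{k=1}^{n}\sum_{l=1}^{n}\left(F_{*u}^{-1}\right)^{i}_{k}\left(F_{*u}^{-1}\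right)^{j}_{l}\left[F^{k}(u)-F^{l}(u)\right].$$
   Context: $FDiff(\mathbb R^n)$ is the formal group of formal diffeomorphisms $X^i(u)=\sum_{(i_1,\dots,i_n)\in\mathbb Z_+^n}x^i_{i_1\dots i_n}(u^1)^{i_1}\cdots(u^n)^{i_n}$, $i=1,\dots,n$, with the determinant of the linear part $\det X_0$ invertible; multiplication is composition. Its function algebra $\mathcal A$ consists of formal power series in the coordinates $x^i_{i_1\dots i_n}$ (with $\det X_0$ invertible), and identities such as those in the claim are understood formally, as identities of power series in $u$ (or $u,v$) with coefficients in $\mathcal A$. $X_{*u}=(\partial X^i(u)/\partial u^j)$ is the Jacobian matrix of $X$ at $u$ (upper index = row, lower index = column), and $j^\infty_uX$ is the infinite jet of $X$ at $u$. The Poisson structure $\Omega$ means the bracket on $\mathcal A$ determined by $\{X^i(u),X^j(v)\}=\Omega^{ij}(j^\infty_uX,j^\infty_vX)$. $\mathbb R((u^1,\dots,u^n))$ denotes formal Laurent series with exponents of each variable bounded below. An (antisymmetric) bivector field $\alpha^{ij}(u)$ is Poisson if $\sum_{s}\left(\alpha^{ks}\frac{\partial \alpha^{ij}}{\partial u^s}+\alpha^{is}\frac{\partial \alpha^{jk}}{\partial u^s}+\alpha^{js}\frac{\partial \alpha^{ki}}{\partial u^s}\right)=0$ for all $i,j,k$. The displayed compatibility equation is the condition that the action map $FDiff(\mathbb R^n)\times\mathbb R^n\to\mathbb R^n$ is Poisson (product Poisson structure on the source). A solution of the CYBE for $W_n$ is a family $\varphi^{ij}(u,v)$, $i,j=1,\dots,n$,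 with $\varphi^{ij}(u,v)=-\varphi^{ji}(v,u)$ such that for all $i,j,k$, with summation over the repeated index $s=1,\dots,n$ understood, $$\begin{aligned}&\varphi^{ks}(w,u)\frac{\partial \varphi^{ij}(u,v)}{\partial u^s}+\varphi^{sk}(v,w)\frac{\partial \varphi^{ji}(v,u)}{\partial v^s}+\varphi^{is}(u,v)\frac{\partial \varphi^{jk}(v,w)}{\partial v^s}\\&+\varphi^{si}(w,u)\frac{\partial \varphi^{kj}(w,v)}{\partial w^s}+\varphi^{js}(v,w)\frac{\partial \varphi^{ki}(w,u)}{\partial w^s}+\varphi^{sj}(u,v)\frac{\partial \varphi^{ik}(u,w)}{\partial u^s}=0.\end{aligned}$$ *)

theory Defs
  imports "HOL-Analysis.Analysis" "HOL-Library.Poly_Mapping"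
begin

section \<open>Formal power series and Laurent series in several variables\<close>

text \<open>
  Exponents are natural numbers (power series) or integers (Laurent series).  The class only
  serves to treat both cases at once.
\<close>

class exponent = comm_monoid_add + one +
  fixes to_int :: "'a \<Rightarrow> int"
  assumes inj_to_int: "inj to_int"
    and to_int_0 [simp]: "to_int 0 = 0"
    and to_int_1 [simp]: "to_int 1 = 1"
    and to_int_add [simp]: "to_int (a + b) = to_int a + to_int b"
begin

lemma to_int_eq_iff [simp]: "to_int a = to_int b \<longleftrightarrow> a = b"
  using inj_to_int by (auto dest: injD)

end

instantiation nat :: exponent
begin
definition to_int_nat :: "nat \<Rightarrow> int" where "to_int_nat = int"
instance by standard (auto simp: to_int_nat_def)
end

instantiation int :: exponent
begin
definition to_int_int :: "int \<Rightarrow> int" where "to_int_int = id"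
instance by standard (auto simp: to_int_int_def)
end

text \<open>
  The variables form the type \<open>'v\<close>, possibly infinite; a monomial is a finitely supported
  exponent vector.  A series is an arbitrary coefficient function whose exponents are bounded
  below in each variable (and by 0 in all but finitely many variables).  For \<open>'e = nat\<close> the
  condition is vacuous and the type is the ring of all formal power series; for \<open>'e = int\<close> and
  finite \<open>'v\<close> it is the ring of formal Laurent series with exponents of each variable
  bounded below.
\<close>

definition bounded_by :: "('v \<Rightarrow>\<^sub>0 int) \<Rightarrow> (('v \<Rightarrow>\<^sub>0 'e::exponent) \<Rightarrow> 'a::zero) \<Rightarrow> bool" where
  "bounded_by N f \<longleftrightarrow> (\<forall>m. f m \<noteq> 0 \<longrightarrow> (\<forall>x. Poly_Mapping.lookup N x \<le> to_int (Poly_Mapping.lookup m x)))"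

typedef (overloaded) ('v, 'e::exponent, 'a::zero) series =
  "{f :: ('v \<Rightarrow>\<^sub>0 'e) \<Rightarrow> 'a. \<exists>N. bounded_by N f}"
  morphisms scoeff Series
  by (rule exI[of _ "\<lambda>_. 0"]) (auto simp: bounded_by_def)

type_synonym ('v, 'a) pseries = "('v, nat, 'a) series"
type_synonym ('v, 'a) lseries = "('v, int, 'a) series"

lemma series_eqI: "(\<And>m. scoeff f m = scoeff g m) \<Longrightarrow> f = g"
  by (metis scoeff_inject ext)

lemma scoeff_bounded: obtains N where "bounded_by N (scoeff f)"
  using scoeff[of f] by auto

lemma scoeff_Series: "bounded_by N f \<Longrightarrow> scoeff (Series f) = f"
  by (subst Series_inverse) auto

lemma scoeff_Series_nat [simp]: "scoeff (Series f :: ('v, nat, 'a::zero) series) = f"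
  by (rule scoeff_Series[of 0]) (auto simp: bounded_by_def to_int_nat_def)

text \<open>The coefficient of \<open>k\<close> in a product is a finite sum by the bounds on the exponents.\<close>

definition splits :: "('v \<Rightarrow>\<^sub>0 int) \<Rightarrow> ('v \<Rightarrow>\<^sub>0 int) \<Rightarrow> ('v \<Rightarrow>\<^sub>0 'e::exponent)
    \<Rightarrow> (('v \<Rightarrow>\<^sub>0 'e) \<times> ('v \<Rightarrow>\<^sub>0 'e)) set" where
  "splits N M k = {(a, b). a + b = k \<and> (\<forall>x. Poly_Mapping.lookup N x \<le> to_int (Poly_Mapping.lookup a x)) \<and>
     (\<forall>x. Poly_Mapping.lookup M x \<le> to_int (Poly_Mapping.lookup b x))}"

lemma splits_bounds:
  assumes "(a, b) \<in> splits N M k"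
  shows "to_int (Poly_Mapping.lookup a x) \<in> {Poly_Mapping.lookup N x .. to_int (Poly_Mapping.lookup k x) - Poly_Mapping.lookup M x}"
    and "to_int (Poly_Mapping.lookup b x) \<in> {Poly_Mapping.lookup M x .. to_int (Poly_Mapping.lookup k x) - Poly_Mapping.lookup N x}"
proof -
  from assms have "a + b = k" by (auto simp: splits_def)
  hence "to_int (Poly_Mapping.lookup a x) + to_int (Poly_Mapping.lookup b x) = to_int (Poly_Mapping.lookup k x)"
    by (metis lookup_add to_int_add)
  moreover have "Poly_Mapping.lookup N x \<le> to_int (Poly_Mapping.lookup a x)" "Poly_Mapping.lookup M x \<le> to_int (Poly_Mapping.lookup b x)"
    using assms by (auto simp: splits_def)
  ultimately show "to_int (Poly_Mapping.lookup a x) \<in> {Poly_Mapping.lookup N x .. to_int (Poly_Mapping.lookup k x) - Poly_Mapping.lookup M x}"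
    "to_int (Poly_Mapping.lookup b x) \<in> {Poly_Mapping.lookup M x .. to_int (Poly_Mapping.lookup k x) - Poly_Mapping.lookup N x}" by auto
qed

lemma finite_exponent_box:
  fixes A B :: "'v \<Rightarrow>\<^sub>0 int"
  shows "finite {m :: 'v \<Rightarrow>\<^sub>0 'e::exponent. \<forall>x. Poly_Mapping.lookup A x \<le> to_int (Poly_Mapping.lookup m x) \<and>
           to_int (Poly_Mapping.lookup m x) \<le> Poly_Mapping.lookup B x}" (is "finite ?S")
proof -
  define D where "D = Poly_Mapping.keys A \<union> Poly_Mapping.keys B"
  have out: "Poly_Mapping.lookup m x = 0" if "m \<in> ?S" "x \<notin> D" for m x
  proof -
    have "Poly_Mapping.lookup A x = 0" "Poly_Mapping.lookup B x = 0" using that by (auto simp: D_def in_keys_iff)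
    hence "to_int (Poly_Mapping.lookup m x) = to_int (0::'e)" using that(1) by (metis (mono_tags, lifting) to_int_0 mem_Collect_eq order_antisym)
    thus ?thesis by (simp only: to_int_eq_iff)
  qed
  let ?h = "\<lambda>m::'v \<Rightarrow>\<^sub>0 'e. restrict (\<lambda>x. to_int (Poly_Mapping.lookup m x)) D"
  have "inj_on ?h ?S"
  proof (rule inj_onI)
    fix a b assume ab: "a \<in> ?S" "b \<in> ?S" and e: "?h a = ?h b"
    show "a = b"
    proof (rule poly_mapping_eqI)
      fix x show "Poly_Mapping.lookup a x = Poly_Mapping.lookup b x"
      proof (cases "x \<in> D")
        case True
        then show ?thesis using fun_cong[OF e, of x] by simp
      next
        case False
        then show ?thesis using out[OF ab(1)] out[OF ab(2)] by simp
      qed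
    qed
  qed
  moreover have "?h ` ?S \<subseteq> PiE D (\<lambda>x. {Poly_Mapping.lookup A x .. Poly_Mapping.lookup B x})" by auto
  moreover have "finite (PiE D (\<lambda>x. {Poly_Mapping.lookup A x .. Poly_Mapping.lookup B x}))"
    by (intro finite_PiE) (auto simp: D_def)
  ultimately show ?thesis by (meson finite_imageD finite_subset)
qed

lemma ex_lookup_to_int: "\<exists>K. \<forall>x. Poly_Mapping.lookup K x = to_int (Poly_Mapping.lookup (k::'v \<Rightarrow>\<^sub>0 'e::exponent) x)"
  by (rule exI[of _ "Poly_Mapping.map to_int k"]) (auto simp: map.rep_eq when_def)

lemma finite_splits [simp, intro]: "finite (splits N M (k :: 'v \<Rightarrow>\<^sub>0 'e::exponent))"
proof -
  obtain K where K: "\<And>x. Poly_Mapping.lookup K x = to_int (Poly_Mapping.lookup k x)" using ex_lookup_to_int by blast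
  let ?A = "{m :: 'v \<Rightarrow>\<^sub>0 'e. \<forall>x. Poly_Mapping.lookup N x \<le> to_int (Poly_Mapping.lookup m x) \<and> to_int (Poly_Mapping.lookup m x) \<le> Poly_Mapping.lookup (K - M) x}"
  let ?B = "{m :: 'v \<Rightarrow>\<^sub>0 'e. \<forall>x. Poly_Mapping.lookup M x \<le> to_int (Poly_Mapping.lookup m x) \<and> to_int (Poly_Mapping.lookup m x) \<le> Poly_Mapping.lookup (K - N) x}"
  have "splits N M k \<subseteq> ?A \<times> ?B"
    using splits_bounds by (fastforce simp: lookup_minus K)
  moreover have "finite (?A \<times> ?B)" by (intro finite_cartesian_product finite_exponent_box)
  ultimately show ?thesis by (rule finite_subset)
qed

instantiation series :: (type, exponent, zero) zero
begin
definition zero_series :: "('a, 'b, 'c) series" where "0 = Series (\<lambda>_. 0)"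
instance ..
end

lemma scoeff_0 [simp]: "scoeff 0 m = 0"
  unfolding zero_series_def by (subst scoeff_Series[of 0]) (auto simp: bounded_by_def)

instantiation series :: (type, exponent, "{one,zero}") one
begin
definition one_series :: "('a, 'b, 'c) series" where "1 = Series (\<lambda>m. if m = 0 then 1 else 0)"
instance ..
end

lemma scoeff_1: "scoeff 1 m = (if m = 0 then 1 else 0)"
  unfolding one_series_def by (subst scoeff_Series[of 0]) (auto simp: bounded_by_def)

lemma bounded_by_mono:
  assumes "bounded_by N f" "\<And>x. Poly_Mapping.lookup M x \<le> Poly_Mapping.lookup N x" shows "bounded_by M f"
  using assms unfolding bounded_by_def by (meson order_trans)

lemma common_bound:
  obtains N where "bounded_by N (scoeff f)" "bounded_by N (scoeff g)"
proof -
  obtain A where A: "bounded_by A (scoeff f)" by (rule scoeff_bounded)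
  obtain B where B: "bounded_by B (scoeff g)" by (rule scoeff_bounded)
  define N where "N = Abs_poly_mapping (\<lambda>x. min (Poly_Mapping.lookup A x) (Poly_Mapping.lookup B x))"
  have "Poly_Mapping.lookup N = (\<lambda>x. min (Poly_Mapping.lookup A x) (Poly_Mapping.lookup B x))"
    unfolding N_def
  proof (rule Abs_poly_mapping_inverse, safe)
    show "finite {x. min (Poly_Mapping.lookup A x) (Poly_Mapping.lookup B x) \<noteq> 0}"
      by (rule finite_subset[of _ "Poly_Mapping.keys A \<union> Poly_Mapping.keys B"]) (auto simp: in_keys_iff min_def split: if_splits)
  qed
  then show ?thesis using that[of N] bounded_by_mono[OF A] bounded_by_mono[OF B] by simp
qed

instantiation series :: (type, exponent, ab_group_add) ab_group_add
begin
definition plus_series :: "('a, 'b, 'c) series \<Rightarrow> _" where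
  "f + g = Series (\<lambda>m. scoeff f m + scoeff g m)"
definition uminus_series :: "('a, 'b, 'c) series \<Rightarrow> _" where
  "- f = Series (\<lambda>m. - scoeff f m)"
definition minus_series :: "('a, 'b, 'c) series \<Rightarrow> _" where
  "f - g = Series (\<lambda>m. scoeff f m - scoeff g m)"

lemma scoeff_add [simp]: "scoeff (f + g) m = scoeff f m + scoeff (g :: ('a, 'b, 'c) series) m"
proof -
  obtain N where "bounded_by N (scoeff f)" "bounded_by N (scoeff g)" by (rule common_bound)
  hence "bounded_by N (\<lambda>m. scoeff f m + scoeff g m)" unfolding bounded_by_def by (metis add_0)
  thus ?thesis by (simp add: plus_series_def scoeff_Series)
qed

lemma scoeff_diff [simp]: "scoeff (f - g) m = scoeff f m - scoeff (g :: ('a, 'b, 'c) series) m"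
proof -
  obtain N where "bounded_by N (scoeff f)" "bounded_by N (scoeff g)" by (rule common_bound)
  hence "bounded_by N (\<lambda>m. scoeff f m - scoeff g m)" unfolding bounded_by_def by (metis diff_0_right)
  thus ?thesis by (simp add: minus_series_def scoeff_Series)
qed

lemma scoeff_uminus [simp]: "scoeff (- f) m = - scoeff (f :: ('a, 'b, 'c) series) m"
proof -
  obtain N where "bounded_by N (scoeff f)" by (rule scoeff_bounded)
  hence "bounded_by N (\<lambda>m. - scoeff f m)" unfolding bounded_by_def by (metis neg_equal_0_iff_equal)
  thus ?thesis by (simp add: uminus_series_def scoeff_Series)
qed

instance by standard (auto intro!: series_eqI simp: algebra_simps)
end

lemma scoeff_sum [simp]: "scoeff (sum f A) m = (\<Sum>i\<in>A. scoeff (f i :: ('a, 'b::exponent, 'c::ab_group_add) series) m)"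
  by (induction A rule: infinite_finite_induct) auto

instantiation series :: (type, exponent, comm_ring) times
begin
definition times_series :: "('a, 'b, 'c) series \<Rightarrow> _" where
  "f * g = Series (\<lambda>k. \<Sum>(a, b) | a + b = k \<and> scoeff f a \<noteq> 0 \<and> scoeff g b \<noteq> 0.
     scoeff f a * scoeff g b)"
instance ..
end

lemma conv_splits:
  fixes f g :: "('v \<Rightarrow>\<^sub>0 'e::exponent) \<Rightarrow> 'a::comm_ring"
  assumes "bounded_by N f" "bounded_by M g"
  shows "(\<Sum>(a, b) | a + b = k \<and> f a \<noteq> 0 \<and> g b \<noteq> 0. f a * g b)
         = (\<Sum>(a, b)\<in>splits N M k. f a * g b)"
proof (rule sum.mono_neutral_left)
  show "{(a, b). a + b = k \<and> f a \<noteq> 0 \<and> g b \<noteq> 0} \<subseteq> splits N M k"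
    using assms by (auto simp: splits_def bounded_by_def)
  show "\<forall>i\<in>splits N M k - {(a, b). a + b = k \<and> f a \<noteq> 0 \<and> g b \<noteq> 0}. (case i of (a, b) \<Rightarrow> f a * g b) = 0"
    by (auto simp: splits_def)
qed auto

lemma bounded_by_conv:
  fixes f g :: "('v \<Rightarrow>\<^sub>0 'e::exponent) \<Rightarrow> 'a::comm_ring"
  assumes "bounded_by N f" "bounded_by M g"
  shows "bounded_by (N + M) (\<lambda>k. \<Sum>(a, b)\<in>splits N M k. f a * g b)"
  unfolding bounded_by_def
proof safe
  fix k x assume "(\<Sum>(a, b)\<in>splits N M k. f a * g b) \<noteq> 0"
  then obtain a b where ab: "(a, b) \<in> splits N M k"
    by (metis (no_types, lifting) all_not_in_conv sum.empty surj_pair)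
  hence "k = a + b" by (auto simp: splits_def)
  thus "Poly_Mapping.lookup (N + M) x \<le> to_int (Poly_Mapping.lookup k x)"
    using ab by (auto simp: lookup_add splits_def intro!: add_mono)
qed

lemma scoeff_mult:
  fixes f g :: "('v, 'e::exponent, 'a::comm_ring) series"
  assumes "bounded_by N (scoeff f)" "bounded_by M (scoeff g)"
  shows "scoeff (f * g) k = (\<Sum>(a, b)\<in>splits N M k. scoeff f a * scoeff g b)"
  unfolding times_series_def
  using conv_splits[OF assms] bounded_by_conv[OF assms] by (simp add: scoeff_Series)

lemma bounded_by_mult:
  fixes f g :: "('v, 'e::exponent, 'a::comm_ring) series"
  assumes "bounded_by N (scoeff f)" "bounded_by M (scoeff g)"
  shows "bounded_by (N + M) (scoeff (f * g))"
  using bounded_by_conv[OF assms] scoeff_mult[OF assms] by (simp add: bounded_by_def)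

lemma scoeff_mult_nat:
  fixes f g :: "('v, 'a::comm_ring) pseries"
  shows "scoeff (f * g) k = (\<Sum>(a, b) | a + b = k. scoeff f a * scoeff g b)"
    and "finite {(a, b). a + b = (k :: 'v \<Rightarrow>\<^sub>0 nat)}"
proof -
  have b: "bounded_by 0 (scoeff h)" for h :: "('v, 'a) pseries"
    by (auto simp: bounded_by_def to_int_nat_def)
  have s: "splits 0 0 k = {(a, b). a + b = k}" by (auto simp: splits_def to_int_nat_def)
  show "scoeff (f * g) k = (\<Sum>(a, b) | a + b = k. scoeff f a * scoeff g b)"
    using scoeff_mult[OF b b, of f g k] by (simp add: s)
  show "finite {(a, b). a + b = (k :: 'v \<Rightarrow>\<^sub>0 nat)}" using finite_splits[of 0 0 k] by (simp add: s)
qed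

instance series :: (type, exponent, comm_ring) comm_ring
proof
  fix f g h :: "('a, 'b, 'c) series"
  obtain N where N: "bounded_by N (scoeff f)" by (rule scoeff_bounded)
  obtain M where M: "bounded_by M (scoeff g)" by (rule scoeff_bounded)
  obtain L where L: "bounded_by L (scoeff h)" by (rule scoeff_bounded)
  show "f * g = g * f"
    by (rule series_eqI, subst scoeff_mult[OF N M], subst scoeff_mult[OF M N],
        rule sum.reindex_bij_witness[of _ prod.swap prod.swap])
      (auto simp: splits_def add.commute mult.commute)
  show "f * g * h = f * (g * h)"
  proof (rule series_eqI)
    fix k
    have "scoeff (f * g * h) k = (\<Sum>(c, d)\<in>splits (N + M) L k. \<Sum>(a, b)\<in>splits N M c.
            scoeff f a * scoeff g b * scoeff h d)"
      by (subst scoeff_mult[OF bounded_by_mult[OF N M] L], subst scoeff_mult[OF N M])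
        (simp add: sum_distrib_right split_def)
    also have "\<dots> = (\<Sum>((c, d), (a, b))\<in>Sigma (splits (N + M) L k) (\<lambda>(c, d). splits N M c).
            scoeff f a * scoeff g b * scoeff h d)"
      by (subst sum.Sigma[symmetric]) (auto simp: split_def)
    also have "\<dots> = (\<Sum>((a, e), (b, d))\<in>Sigma (splits N (M + L) k) (\<lambda>(a, e). splits M L e).
            scoeff f a * scoeff g b * scoeff h d)"
      by (rule sum.reindex_bij_witness[of _ "\<lambda>((a, e), (b, d)). ((a + b, d), (a, b))"
            "\<lambda>((c, d), (a, b)). ((a, b + d), (b, d))"])
        (auto simp: splits_def add.assoc lookup_add intro!: add_mono)
    also have "\<dots> = (\<Sum>(a, e)\<in>splits N (M + L) k. \<Sum>(b, d)\<in>splits M L e.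
            scoeff f a * scoeff g b * scoeff h d)"
      by (subst sum.Sigma[symmetric]) (auto simp: split_def)
    also have "\<dots> = scoeff (f * (g * h)) k"
      by (subst scoeff_mult[OF N bounded_by_mult[OF M L]], subst scoeff_mult[OF M L])
        (simp add: sum_distrib_left split_def mult.assoc)
    finally show "scoeff (f * g * h) k = scoeff (f * (g * h)) k" .
  qed
  obtain K where K: "bounded_by K (scoeff f)" "bounded_by K (scoeff g)" by (rule common_bound)
  have K': "bounded_by K (scoeff (f + g))" using K unfolding bounded_by_def by (metis add_0 scoeff_add)
  show "(f + g) * h = f * h + g * h"
    by (rule series_eqI)
      (simp add: scoeff_mult[OF K' L] scoeff_mult[OF K(1) L] scoeff_mult[OF K(2) L]
        sum.distrib[symmetric] split_def distrib_right)
qed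

instance series :: (type, exponent, comm_ring_1) comm_ring_1
proof
  fix f :: "('a, 'b, 'c) series"
  obtain N where N: "bounded_by N (scoeff f)" by (rule scoeff_bounded)
  have o: "bounded_by 0 (scoeff (1 :: ('a, 'b, 'c) series))" by (auto simp: bounded_by_def scoeff_1)
  show "1 * f = f"
  proof (rule series_eqI)
    fix k
    have "scoeff (1 * f) k = (\<Sum>(a, b)\<in>splits 0 N k. scoeff 1 a * scoeff f b)" by (rule scoeff_mult[OF o N])
    also have "\<dots> = (\<Sum>(a, b)\<in>splits 0 N k \<inter> {(0, k)}. scoeff 1 a * scoeff f b)"
    proof (rule sum.mono_neutral_right)
      show "\<forall>i\<in>splits 0 N k - splits 0 N k \<inter> {(0, k)}. (case i of (a, b) \<Rightarrow> scoeff 1 a * scoeff f b) = 0"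
      proof
        fix p assume p: "p \<in> splits 0 N k - splits 0 N k \<inter> {(0, k)}"
        obtain a b where ab: "p = (a, b)" by (cases p)
        have "a \<noteq> 0" using p by (auto simp: ab splits_def)
        thus "(case p of (a, b) \<Rightarrow> scoeff 1 a * scoeff f b) = 0" by (simp add: ab scoeff_1)
      qed
    qed auto
    also have "\<dots> = scoeff f k"
    proof (cases "scoeff f k = 0")
      case True
      have "(\<Sum>(a, b)\<in>splits 0 N k \<inter> {(0, k)}. scoeff 1 a * scoeff f b) = 0"
        by (rule sum.neutral) (use True in auto)
      thus ?thesis using True by simp
    next
      case False
      hence "splits 0 N k \<inter> {(0, k)} = {(0, k)}" using N by (auto simp: splits_def bounded_by_def)
      thus ?thesis by (simp add: scoeff_1)
    qed
    finally show "scoeff (1 * f) k = scoeff f k" .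
  qed
  have "scoeff (0 :: ('a, 'b, 'c) series) 0 \<noteq> scoeff 1 0" by (simp add: scoeff_1)
  thus "(0 :: ('a, 'b, 'c) series) \<noteq> 1" by metis
qed


definition const :: "'a::zero \<Rightarrow> ('v, 'a) pseries" where
  "const c = Series (\<lambda>m. if m = 0 then c else 0)"

definition var :: "'v \<Rightarrow> ('v, 'a::{zero,one}) pseries" where
  "var x = Series (\<lambda>m. if m = Poly_Mapping.single x 1 then 1 else 0)"

definition map_coeffs :: "('a::zero \<Rightarrow> 'b::zero) \<Rightarrow> ('v, 'a) pseries \<Rightarrow> ('v, 'b) pseries" where
  "map_coeffs h f = Series (\<lambda>m. h (scoeff f m))"

definition to_laurent :: "('v, 'a::zero) pseries \<Rightarrow> ('v, 'a) lseries" where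
  "to_laurent f = Series (\<lambda>m. if \<forall>x. 0 \<le> Poly_Mapping.lookup m x
     then scoeff f (Poly_Mapping.map nat m) else 0)"

lemma scoeff_to_laurent:
  "scoeff (to_laurent f) m = (if \<forall>x. 0 \<le> Poly_Mapping.lookup m x
     then scoeff f (Poly_Mapping.map nat m) else 0)"
  unfolding to_laurent_def by (subst scoeff_Series[of 0]) (auto simp: bounded_by_def to_int_int_def)

definition pderiv_series :: "'v \<Rightarrow> ('v, 'e::exponent, 'a::comm_ring_1) series \<Rightarrow> ('v, 'e, 'a) series"
    where
  "pderiv_series x f = Series (\<lambda>m. of_int (to_int (Poly_Mapping.lookup m x + 1)) *
     scoeff f (m + Poly_Mapping.single x 1))"

lemma scoeff_pderiv_series:
  "scoeff (pderiv_series x f) m = of_int (to_int (Poly_Mapping.lookup m x + 1)) *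
     scoeff f (m + Poly_Mapping.single x 1)"
proof -
  obtain N where N: "bounded_by N (scoeff f)" by (rule scoeff_bounded)
  have "bounded_by (N - Poly_Mapping.single x 1) (\<lambda>m. of_int (to_int (Poly_Mapping.lookup m x + 1)) *
     scoeff f (m + Poly_Mapping.single x 1))"
    unfolding bounded_by_def
  proof safe
    fix m y assume "of_int (to_int (Poly_Mapping.lookup m x + 1)) * scoeff f (m + Poly_Mapping.single x 1) \<noteq> 0"
    hence "scoeff f (m + Poly_Mapping.single x 1) \<noteq> 0" by auto
    with N have "Poly_Mapping.lookup N y \<le> to_int (Poly_Mapping.lookup (m + Poly_Mapping.single x 1) y)"
      unfolding bounded_by_def by blast
    thus "Poly_Mapping.lookup (N - Poly_Mapping.single x 1) y \<le> to_int (Poly_Mapping.lookup m y)"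
      by (auto simp: Poly_Mapping.lookup_add lookup_minus lookup_single when_def)
  qed
  thus ?thesis by (simp add: pderiv_series_def scoeff_Series)
qed

text \<open>
  \<open>rename \<rho> f\<close> is \<open>f\<close> with every variable \<open>x\<close> replaced by \<open>\<rho> x\<close>.  Identifying variables
  (as in \<open>f(u, u)\<close>) makes sense also for Laurent series, because exponents are bounded below.
\<close>

definition push_exponent :: "('v::finite \<Rightarrow> 'w) \<Rightarrow> ('v \<Rightarrow>\<^sub>0 'e::exponent) \<Rightarrow> ('w \<Rightarrow>\<^sub>0 'e)" where
  "push_exponent \<rho> m = (\<Sum>x\<in>UNIV. Poly_Mapping.single (\<rho> x) (Poly_Mapping.lookup m x))"

definition rename :: "('v::finite \<Rightarrow> 'w) \<Rightarrow> ('v, 'e::exponent, 'a::comm_monoid_add) series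
    \<Rightarrow> ('w, 'e, 'a) series" where
  "rename \<rho> f = Series (\<lambda>k. \<Sum>m | scoeff f m \<noteq> 0 \<and> push_exponent \<rho> m = k. scoeff f m)"

lemma lookup_push_exponent:
  "Poly_Mapping.lookup (push_exponent \<rho> m) y = (\<Sum>x | \<rho> x = y. Poly_Mapping.lookup m x)"
  by (simp add: push_exponent_def lookup_sum lookup_single when_def sum.If_cases)

lemma to_int_sum: "to_int (sum f A) = (\<Sum>x\<in>A. to_int (f x))"
  by (induction A rule: infinite_finite_induct) auto

lemma finite_push_exponent:
  fixes f :: "('v::finite, 'e::exponent, 'a::comm_monoid_add) series"
  shows "finite {m. scoeff f m \<noteq> 0 \<and> push_exponent \<rho> m = k}"
proof -
  obtain N where N: "bounded_by N (scoeff f)" by (rule scoeff_bounded)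
  define B where "B = (\<Sum>x\<in>UNIV. Poly_Mapping.single x (to_int (Poly_Mapping.lookup k (\<rho> x))
      - (\<Sum>z | \<rho> z = \<rho> x \<and> z \<noteq> x. Poly_Mapping.lookup N z)))"
  have B: "Poly_Mapping.lookup B x = to_int (Poly_Mapping.lookup k (\<rho> x))
      - (\<Sum>z | \<rho> z = \<rho> x \<and> z \<noteq> x. Poly_Mapping.lookup N z)" for x
    by (simp add: B_def lookup_sum lookup_single when_def)
  have "{m. scoeff f m \<noteq> 0 \<and> push_exponent \<rho> m = k} \<subseteq> {m. \<forall>x. Poly_Mapping.lookup N x \<le>
      to_int (Poly_Mapping.lookup m x) \<and> to_int (Poly_Mapping.lookup m x) \<le> Poly_Mapping.lookup B x}"
  proof safe
    fix m x assume m: "scoeff f m \<noteq> 0" and k: "k = push_exponent \<rho> m"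
    have le: "Poly_Mapping.lookup N y \<le> to_int (Poly_Mapping.lookup m y)" for y
      using N m by (auto simp: bounded_by_def)
    show "Poly_Mapping.lookup N x \<le> to_int (Poly_Mapping.lookup m x)" by (rule le)
    have "to_int (Poly_Mapping.lookup k (\<rho> x)) = (\<Sum>z | \<rho> z = \<rho> x. to_int (Poly_Mapping.lookup m z))"
      by (simp add: k lookup_push_exponent to_int_sum)
    also have "{z. \<rho> z = \<rho> x} = insert x {z. \<rho> z = \<rho> x \<and> z \<noteq> x}" by auto
    also have "(\<Sum>z\<in>\<dots>. to_int (Poly_Mapping.lookup m z)) = to_int (Poly_Mapping.lookup m x) +
        (\<Sum>z | \<rho> z = \<rho> x \<and> z \<noteq> x. to_int (Poly_Mapping.lookup m z))" by (subst sum.insert) auto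
    also have "\<dots> \<ge> to_int (Poly_Mapping.lookup m x) + (\<Sum>z | \<rho> z = \<rho> x \<and> z \<noteq> x. Poly_Mapping.lookup N z)"
      by (intro add_left_mono sum_mono le)
    finally show "to_int (Poly_Mapping.lookup m x) \<le> Poly_Mapping.lookup B x" by (simp add: B k)
  qed
  thus ?thesis by (rule finite_subset) (rule finite_exponent_box)
qed

lemma scoeff_rename:
  "scoeff (rename \<rho> f) k = (\<Sum>m | scoeff f m \<noteq> 0 \<and> push_exponent \<rho> m = k. scoeff f m)"
proof -
  obtain N where N: "bounded_by N (scoeff f)" by (rule scoeff_bounded)
  have "bounded_by (push_exponent \<rho> N)
      (\<lambda>k. \<Sum>m | scoeff f m \<noteq> 0 \<and> push_exponent \<rho> m = k. scoeff f m)"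
    unfolding bounded_by_def
  proof safe
    fix k y assume "(\<Sum>m | scoeff f m \<noteq> 0 \<and> push_exponent \<rho> m = k. scoeff f m) \<noteq> 0"
    from sum.not_neutral_contains_not_neutral[OF this]
    obtain m where m: "scoeff f m \<noteq> 0" "push_exponent \<rho> m = k" by blast
    show "Poly_Mapping.lookup (push_exponent \<rho> N) y \<le> to_int (Poly_Mapping.lookup k y)"
      unfolding m(2)[symmetric] lookup_push_exponent to_int_sum
      using N m(1) by (intro sum_mono) (auto simp: bounded_by_def)
  qed
  thus ?thesis by (simp add: rename_def scoeff_Series)
qed

text \<open>
  \<open>at2 p q f\<close> is \<open>f(p, q)\<close> for \<open>f \<in> R[[u, v]]\<close> or \<open>R((u, v))\<close>; the variables \<open>u\<^sup>s\<close> and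
  \<open>v\<^sup>s\<close> are \<open>Inl s\<close> and \<open>Inr s\<close>.
\<close>

abbreviation at2 :: "('n::finite \<Rightarrow> 'w) \<Rightarrow> ('n \<Rightarrow> 'w) \<Rightarrow> ('n + 'n, 'e::exponent, 'a::comm_monoid_add) series
    \<Rightarrow> ('w, 'e, 'a) series" where
  "at2 p q \<equiv> rename (case_sum p q)"

abbreviation diagonal :: "('n::finite + 'n, 'e::exponent, 'a::comm_monoid_add) series
    \<Rightarrow> ('n, 'e, 'a) series" where
  "diagonal \<equiv> at2 id id"

text \<open>
  Substitution of series whose coefficients are themselves power series in variables of type
  \<open>'c\<close>.  The outer series may have nonzero constant coefficient (as \<open>X\<^sup>i(u)\<close> has); the sum over
  \<open>m\<close> is finite for fixed \<open>k\<close> whenever that coefficient has no constant term in the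
  variables \<open>'c\<close>.
\<close>

definition subst_series :: "('v::finite \<Rightarrow> ('w, ('c, 'a::comm_ring_1) pseries) pseries) \<Rightarrow> ('v, 'a) pseries
    \<Rightarrow> ('w, ('c, 'a) pseries) pseries" where
  "subst_series g f = Series (\<lambda>K. Series (\<lambda>k.
     Sum_any (\<lambda>m. scoeff f m * scoeff (scoeff (\<Prod>x\<in>UNIV. g x ^ Poly_Mapping.lookup m x) K) k)))"


section \<open>The classical Yang-Baxter equation and Poisson bivector fields\<close>

abbreviation (input) "pu \<equiv> Inl"
abbreviation (input) "pv \<equiv> (\<lambda>s. Inr (Inl s))"
abbreviation (input) "pw \<equiv> (\<lambda>s. Inr (Inr s))"

definition cybe_solution :: "('n::finite \<Rightarrow> 'n \<Rightarrow> ('n + 'n, real) pseries) \<Rightarrow> bool" where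
  "cybe_solution \<phi> \<longleftrightarrow>
     (\<forall>i j. \<phi> i j = - at2 Inr Inl (\<phi> j i)) \<and>
     (\<forall>i j k. (\<Sum>s\<in>UNIV.
        at2 pw pu (\<phi> k s) * pderiv_series (pu s) (at2 pu pv (\<phi> i j))
      + at2 pv pw (\<phi> s k) * pderiv_series (pv s) (at2 pv pu (\<phi> j i))
      + at2 pu pv (\<phi> i s) * pderiv_series (pv s) (at2 pv pw (\<phi> j k))
      + at2 pw pu (\<phi> s i) * pderiv_series (pw s) (at2 pw pv (\<phi> k j))
      + at2 pv pw (\<phi> j s) * pderiv_series (pw s) (at2 pw pu (\<phi> k i))
      + at2 pu pv (\<phi> s j) * pderiv_series (pu s) (at2 pu pw (\<phi> i k))
        :: ('n + 'n + 'n, real) pseries) = 0)"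

definition poisson_bivector :: "('n::finite \<Rightarrow> 'n \<Rightarrow> ('n, real) pseries) \<Rightarrow> bool" where
  "poisson_bivector \<alpha> \<longleftrightarrow>
     (\<forall>i j. \<alpha> i j = - \<alpha> j i) \<and>
     (\<forall>i j k. (\<Sum>s\<in>UNIV. \<alpha> k s * pderiv_series s (\<alpha> i j)
        + \<alpha> i s * pderiv_series s (\<alpha> j k) + \<alpha> j s * pderiv_series s (\<alpha> k i)) = 0)"


section \<open>The function algebra of the group of formal diffeomorphisms\<close>

text \<open>\<open>(i, I)\<close> is the coordinate \<open>x\<^sup>i\<^sub>I\<close>, the coefficient of \<open>u\<^sup>I\<close> in \<open>X\<^sup>i(u)\<close>.\<close>

type_synonym 'n coord = "'n \<times> ('n \<Rightarrow>\<^sub>0 nat)"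

definition lin_part :: "('n coord, real) pseries ^ 'n ^ 'n" where
  "lin_part = (\<chi> i j. var (i, Poly_Mapping.single j 1))"

definition lin_det :: "('n::finite coord, real) pseries" where
  "lin_det = det lin_part"

text \<open>
  The algebra \<open>\<A>\<close> is the localization of the power series ring in all coordinates at
  \<open>det X\<^sub>0\<close>; the pair \<open>(f, k)\<close> represents \<open>f / (det X\<^sub>0)\<^sup>k\<close>.
\<close>

definition loc_rel :: "('n::finite coord, real) pseries \<times> nat \<Rightarrow> ('n coord, real) pseries \<times> nat \<Rightarrow> bool" where
  "loc_rel p q \<longleftrightarrow> (\<exists>m. lin_det ^ m * (fst p * lin_det ^ snd q) = lin_det ^ m * (fst q * lin_det ^ snd p))"

lemma equivp_loc_rel: "equivp loc_rel"
proof (rule equivpI)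
  show "reflp loc_rel" by (auto intro!: reflpI simp: loc_rel_def)
  show "symp loc_rel" by (rule sympI) (auto simp: loc_rel_def intro: sym)
  show "transp (loc_rel :: _ \<Rightarrow> ('a coord, real) pseries \<times> nat \<Rightarrow> bool)"
  proof (rule transpI)
    fix p q r :: "('a coord, real) pseries \<times> nat"
    let ?d = "lin_det :: ('a coord, real) pseries"
    assume "loc_rel p q" "loc_rel q r"
    then obtain m m' where
      m: "?d ^ m * (fst p * ?d ^ snd q) = ?d ^ m * (fst q * ?d ^ snd p)" and
      m': "?d ^ m' * (fst q * ?d ^ snd r) = ?d ^ m' * (fst r * ?d ^ snd q)"
      by (auto simp: loc_rel_def)
    have "?d ^ (m + m' + snd q) * (fst p * ?d ^ snd r)
        = ?d ^ m' * ?d ^ snd r * (?d ^ m * (fst p * ?d ^ snd q))" by (simp add: power_add ac_simps)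
    also have "\<dots> = ?d ^ m * ?d ^ snd p * (?d ^ m' * (fst q * ?d ^ snd r))"
      unfolding m by (simp add: ac_simps)
    also have "\<dots> = ?d ^ (m + m' + snd q) * (fst r * ?d ^ snd p)"
      unfolding m' by (simp add: power_add ac_simps)
    finally show "loc_rel p r" unfolding loc_rel_def by blast
  qed
qed

quotient_type (overloaded) 'n fdiff_fun = "('n::finite coord, real) pseries \<times> nat" / loc_rel
  by (rule equivp_loc_rel)

lemma scoeff_const: "scoeff (const c) m = (if m = 0 then c else 0)"
  by (simp add: const_def)

lemma scoeff_var: "scoeff (var x) m = (if m = Poly_Mapping.single x 1 then 1 else 0)"
  by (simp add: var_def)

text \<open>
  Nontriviality of \<open>\<A>\<close>: deleting all monomials that involve off-diagonal coordinates is a ring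
  homomorphism, which maps \<open>det X\<^sub>0\<close> to the product of the diagonal coordinates.
\<close>

definition restrict_vars :: "'v set \<Rightarrow> ('v, 'a::zero) pseries \<Rightarrow> ('v, 'a) pseries" where
  "restrict_vars D f = Series (\<lambda>m. if Poly_Mapping.keys m \<subseteq> D then scoeff f m else 0)"

lemma scoeff_restrict_vars:
  "scoeff (restrict_vars D f) m = (if Poly_Mapping.keys m \<subseteq> D then scoeff f m else 0)"
  by (simp add: restrict_vars_def)

lemma keys_add_nat: "Poly_Mapping.keys (a + b :: 'v \<Rightarrow>\<^sub>0 nat) = Poly_Mapping.keys a \<union> Poly_Mapping.keys b"
  by (auto simp: in_keys_iff Poly_Mapping.lookup_add)

lemma restrict_vars_mult:
  "restrict_vars D (f * g :: ('v, 'a::comm_ring) pseries) = restrict_vars D f * restrict_vars D g"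
proof (rule series_eqI)
  fix k
  show "scoeff (restrict_vars D (f * g)) k = scoeff (restrict_vars D f * restrict_vars D g) k"
  proof (cases "Poly_Mapping.keys k \<subseteq> D")
    case True
    then show ?thesis
      by (auto simp: scoeff_restrict_vars scoeff_mult_nat keys_add_nat intro!: sum.cong)
  next
    case False
    then have "(\<Sum>(a, b) | a + b = k. scoeff (restrict_vars D f) a * scoeff (restrict_vars D g) b) = 0"
      by (intro sum.neutral) (auto simp: scoeff_restrict_vars keys_add_nat)
    with False show ?thesis by (simp add: scoeff_restrict_vars scoeff_mult_nat)
  qed
qed

lemma restrict_vars_1: "restrict_vars D (1 :: ('v, 'a::comm_ring_1) pseries) = 1"
  by (rule series_eqI) (auto simp: scoeff_restrict_vars scoeff_1)

lemma restrict_vars_0: "restrict_vars D (0 :: ('v, 'a::comm_ring_1) pseries) = 0"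
  by (rule series_eqI) (auto simp: scoeff_restrict_vars)

lemma restrict_vars_add:
  "restrict_vars D (f + g :: ('v, 'a::ab_group_add) pseries) = restrict_vars D f + restrict_vars D g"
  by (rule series_eqI) (auto simp: scoeff_restrict_vars)

lemma restrict_vars_uminus:
  "restrict_vars D (- f :: ('v, 'a::ab_group_add) pseries) = - restrict_vars D f"
  by (rule series_eqI) (auto simp: scoeff_restrict_vars)

lemma restrict_vars_sum:
  "restrict_vars D (\<Sum>i\<in>A. f i :: ('v, 'a::comm_ring_1) pseries) = (\<Sum>i\<in>A. restrict_vars D (f i))"
  by (induction A rule: infinite_finite_induct) (simp_all add: restrict_vars_0 restrict_vars_add)

lemma restrict_vars_prod:
  "restrict_vars D (\<Prod>i\<in>A. f i :: ('v, 'a::comm_ring_1) pseries) = (\<Prod>i\<in>A. restrict_vars D (f i))"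
  by (induction A rule: infinite_finite_induct) (simp_all add: restrict_vars_1 restrict_vars_mult)

lemma restrict_vars_power:
  "restrict_vars D (f ^ k :: ('v, 'a::comm_ring_1) pseries) = restrict_vars D f ^ k"
  by (induction k) (simp_all add: restrict_vars_1 restrict_vars_mult)

lemma restrict_vars_det:
  fixes A :: "('v, 'a::comm_ring_1) pseries ^ 'n ^ 'n"
  shows "restrict_vars D (det A) = det (\<chi> i j. restrict_vars D (A $ i $ j))"
proof -
  have "restrict_vars D (of_int (sign p) * x) = of_int (sign p) * restrict_vars D x"
    for p :: "'n \<Rightarrow> 'n" and x :: "('v, 'a) pseries"
    by (auto simp: sign_def restrict_vars_uminus)
  thus ?thesis by (simp add: det_def restrict_vars_sum restrict_vars_prod)
qed

definition monomial :: "('v \<Rightarrow>\<^sub>0 nat) \<Rightarrow> ('v, 'a::{zero,one}) pseries" where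
  "monomial k = Series (\<lambda>m. if m = k then 1 else 0)"

lemma monomial_mult: "monomial k * monomial l = (monomial (k + l) :: ('v, 'a::comm_ring_1) pseries)"
proof (rule series_eqI)
  fix m
  have "scoeff (monomial k * monomial l :: ('v, 'a) pseries) m =
    (\<Sum>p | fst p + snd p = m. if p = (k, l) then 1 else 0)"
    unfolding scoeff_mult_nat by (rule sum.cong) (auto simp: monomial_def split: if_splits)
  also have "\<dots> = (if m = k + l then 1 else 0)"
    using scoeff_mult_nat(2)[of m] by (subst sum.delta) (auto simp: split_def)
  finally show "scoeff (monomial k * monomial l) m = scoeff (monomial (k + l) :: ('v, 'a) pseries) m"
    by (simp add: monomial_def)
qed

lemma monomial_0: "monomial 0 = (1 :: ('v, 'a::comm_ring_1) pseries)"
  by (rule series_eqI) (simp add: monomial_def scoeff_1)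

lemma monomial_prod:
  "(\<Prod>i\<in>A. monomial (k i)) = (monomial (\<Sum>i\<in>A. k i) :: ('v, 'a::comm_ring_1) pseries)"
  by (induction A rule: infinite_finite_induct) (simp_all add: monomial_0 monomial_mult)

lemma monomial_neq_0: "monomial k \<noteq> (0 :: ('v, 'a::comm_ring_1) pseries)"
proof
  assume "monomial k = (0 :: ('v, 'a) pseries)"
  hence "scoeff (monomial k :: ('v, 'a) pseries) k = 0" by simp
  thus False by (simp add: monomial_def)
qed

lemma lin_det_power_neq_0: "(lin_det :: ('n::finite coord, real) pseries) ^ k \<noteq> 0"
proof
  define D :: "'n coord set" where "D = range (\<lambda>i. (i, Poly_Mapping.single i 1))"
  assume "(lin_det :: ('n coord, real) pseries) ^ k = 0"
  hence "restrict_vars D (lin_det ^ k) = 0" by (simp add: restrict_vars_0)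
  hence 0: "restrict_vars D lin_det ^ k = 0" by (simp add: restrict_vars_power)
  let ?A = "\<chi> i j. restrict_vars D (lin_part $ i $ j :: ('n coord, real) pseries)"
  have inD: "(i, Poly_Mapping.single j (1::nat)) \<in> D \<longleftrightarrow> i = j" for i j
  proof
    assume "(i, Poly_Mapping.single j (1::nat)) \<in> D"
    then have "Poly_Mapping.single j (1::nat) = Poly_Mapping.single i 1" by (auto simp: D_def)
    hence "Poly_Mapping.lookup (Poly_Mapping.single j (1::nat)) i = 1" by simp
    thus "i = j" by (simp add: lookup_single when_def split: if_splits)
  qed (auto simp: D_def)
  have A: "?A $ i $ j = (if i = j then monomial (Poly_Mapping.single (i, Poly_Mapping.single i 1) 1) else 0)" for i j
    by (rule series_eqI) (use inD[of i j] in \<open>auto simp: lin_part_def scoeff_restrict_vars scoeff_var monomial_def\<close>)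
  have "restrict_vars D (lin_det :: ('n coord, real) pseries) = det ?A"
    by (simp add: lin_det_def restrict_vars_det)
  also have "\<dots> = (\<Prod>i\<in>UNIV. ?A $ i $ i)" by (rule det_diagonal) (simp only: A if_False)
  also have "\<dots> = monomial (\<Sum>i\<in>UNIV. Poly_Mapping.single (i, Poly_Mapping.single i 1) 1)"
    by (simp only: A if_True refl monomial_prod)
  finally have "(monomial (\<Sum>i\<in>UNIV. Poly_Mapping.single (i, Poly_Mapping.single i 1) 1)
      :: ('n coord, real) pseries) ^ k = 0" using 0 by simp
  moreover have "monomial m ^ k = (monomial (\<Sum>i<k. m) :: ('n coord, real) pseries)" for m
    by (induction k) (simp_all add: monomial_0 monomial_mult add.commute)
  ultimately show False by (simp only: monomial_neq_0)
qed

lemma loc_relI: "fst p * lin_det ^ snd q = fst q * lin_det ^ snd p \<Longrightarrow> loc_rel p q"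
  unfolding loc_rel_def by (rule exI[of _ 0]) simp

instantiation fdiff_fun :: (finite) comm_ring_1
begin

lift_definition zero_fdiff_fun :: "'a fdiff_fun" is "(0, 0)" .

lift_definition one_fdiff_fun :: "'a fdiff_fun" is "(1, 0)" .

lift_definition uminus_fdiff_fun :: "'a fdiff_fun \<Rightarrow> 'a fdiff_fun" is "\<lambda>(f, k). (- f, k)"
  by (auto simp: loc_rel_def)

lift_definition times_fdiff_fun :: "'a fdiff_fun \<Rightarrow> 'a fdiff_fun \<Rightarrow> 'a fdiff_fun"
  is "\<lambda>(f, k) (g, l). (f * g, k + l)"
proof (clarsimp simp: loc_rel_def)
  fix f f' g g' :: "('a coord, real) pseries" and k k' l l' m n
  let ?d = "lin_det :: ('a coord, real) pseries"
  assume 1: "?d ^ m * (f * ?d ^ k') = ?d ^ m * (f' * ?d ^ k)"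
    and 2: "?d ^ n * (g * ?d ^ l') = ?d ^ n * (g' * ?d ^ l)"
  have "?d ^ (m + n) * (f * g * ?d ^ (k' + l')) = (?d ^ m * (f * ?d ^ k')) * (?d ^ n * (g * ?d ^ l'))"
    by (simp add: power_add ac_simps)
  also have "\<dots> = ?d ^ (m + n) * (f' * g' * ?d ^ (k + l))"
    unfolding 1 2 by (simp add: power_add ac_simps)
  finally show "\<exists>m. ?d ^ m * (f * g * ?d ^ (k' + l')) = ?d ^ m * (f' * g' * ?d ^ (k + l))" ..
qed

lift_definition plus_fdiff_fun :: "'a fdiff_fun \<Rightarrow> 'a fdiff_fun \<Rightarrow> 'a fdiff_fun"
  is "\<lambda>(f, k) (g, l). (f * lin_det ^ l + g * lin_det ^ k, k + l)"
proof (clarsimp simp: loc_rel_def)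
  fix f f' g g' :: "('a coord, real) pseries" and k k' l l' m n
  let ?d = "lin_det :: ('a coord, real) pseries"
  assume 1: "?d ^ m * (f * ?d ^ k') = ?d ^ m * (f' * ?d ^ k)"
    and 2: "?d ^ n * (g * ?d ^ l') = ?d ^ n * (g' * ?d ^ l)"
  have "?d ^ (m + n) * ((f * ?d ^ l + g * ?d ^ k) * ?d ^ (k' + l')) =
      ?d ^ (n + l + l') * (?d ^ m * (f * ?d ^ k')) + ?d ^ (m + k + k') * (?d ^ n * (g * ?d ^ l'))"
    by (simp add: power_add algebra_simps)
  also have "\<dots> = ?d ^ (m + n) * ((f' * ?d ^ l' + g' * ?d ^ k') * ?d ^ (k + l))"
    unfolding 1 2 by (simp add: power_add algebra_simps)
  finally show "\<exists>m. ?d ^ m * ((f * ?d ^ l + g * ?d ^ k) * ?d ^ (k' + l')) =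
      ?d ^ m * ((f' * ?d ^ l' + g' * ?d ^ k') * ?d ^ (k + l))" ..
qed

definition minus_fdiff_fun :: "'a fdiff_fun \<Rightarrow> 'a fdiff_fun \<Rightarrow> 'a fdiff_fun" where
  "a - b = a + - (b :: 'a fdiff_fun)"

instance
proof
  fix a b c :: "'a fdiff_fun"
  show "a + b + c = a + (b + c)"
    by (transfer, rule loc_relI) (auto simp: power_add algebra_simps)
  show "a + b = b + a" by (transfer, rule loc_relI) (auto simp: algebra_simps)
  show "0 + a = a" by (transfer, rule loc_relI) auto
  show "- a + a = 0" by (transfer, rule loc_relI) auto
  show "a - b = a + - b" by (simp add: minus_fdiff_fun_def)
  show "a * b * c = a * (b * c)" by (transfer, rule loc_relI) (auto simp: algebra_simps)
  show "a * b = b * a" by (transfer, rule loc_relI) (auto simp: algebra_simps)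
  show "1 * a = a" by (transfer, rule loc_relI) auto
  show "(a + b) * c = a * c + b * c"
    by (transfer, rule loc_relI) (auto simp: power_add algebra_simps)
  show "(0 :: 'a fdiff_fun) \<noteq> 1"
    by transfer (use lin_det_power_neq_0 in \<open>auto simp: loc_rel_def\<close>)
qed
end

definition to_fdiff_fun :: "('n::finite coord, real) pseries \<Rightarrow> 'n fdiff_fun" where
  "to_fdiff_fun f = abs_fdiff_fun (f, 0)"

lemma pderiv_series_add:
  "pderiv_series x (f + g) = pderiv_series x f + pderiv_series x (g :: ('v, 'e::exponent, 'a::comm_ring_1) series)"
  by (rule series_eqI) (simp add: scoeff_pderiv_series distrib_left)

lemma pderiv_series_mult:
  fixes f g :: "('v, 'a::comm_ring_1) pseries"
  shows "pderiv_series x (f * g) = pderiv_series x f * g + f * pderiv_series x g"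
proof (rule series_eqI)
  fix m
  let ?e = "Poly_Mapping.single x (1::nat)"
  let ?F = "scoeff f" and ?G = "scoeff g"
  let ?S = "\<lambda>k. {(a, b). a + b = (k :: 'v \<Rightarrow>\<^sub>0 nat)}"
  have shift: "(\<Sum>(a, b)\<in>?S (m + ?e). of_nat (Poly_Mapping.lookup a x) * (p a * q b)) =
      (\<Sum>(a, b)\<in>?S m. of_nat (Poly_Mapping.lookup a x + 1) * (p (a + ?e) * q b))"
    for p q :: "('v \<Rightarrow>\<^sub>0 nat) \<Rightarrow> 'a"
  proof -
    have "(\<Sum>(a, b)\<in>?S (m + ?e). of_nat (Poly_Mapping.lookup a x) * (p a * q b)) =
        (\<Sum>(a, b)\<in>{(a, b)\<in>?S (m + ?e). Poly_Mapping.lookup a x \<noteq> 0}. of_nat (Poly_Mapping.lookup a x) * (p a * q b))"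
      using scoeff_mult_nat(2)[of "m + ?e"] by (intro sum.mono_neutral_right) (auto intro!: Nat.gr0I)
    also have "\<dots> = (\<Sum>(a, b)\<in>?S m. of_nat (Poly_Mapping.lookup a x + 1) * (p (a + ?e) * q b))"
    proof (rule sum.reindex_bij_witness[of _ "\<lambda>(a, b). (a + ?e, b)" "\<lambda>(a, b). (a - ?e, b)"])
      have r: "a - ?e + ?e = a" if "Poly_Mapping.lookup a x \<noteq> 0" for a
        by (rule poly_mapping_eqI)
          (use that in \<open>auto simp: Poly_Mapping.lookup_add lookup_minus lookup_single when_def\<close>)
      fix p assume "p \<in> {(a, b) \<in> ?S (m + ?e). Poly_Mapping.lookup a x \<noteq> 0}"
      then obtain a b where ab: "p = (a, b)" "a + b = m + ?e" "Poly_Mapping.lookup a x \<noteq> 0" by auto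
      show "(case case p of (a, b) \<Rightarrow> (a - ?e, b) of (a, b) \<Rightarrow> (a + ?e, b)) = p"
        using r ab by simp
      have "(a - ?e) + b + ?e = m + ?e" using r[OF ab(3)] ab(2) by (metis add.assoc add.commute)
      thus "(case p of (a, b) \<Rightarrow> (a - ?e, b)) \<in> ?S m" by (simp add: ab)
    next
      fix p assume "p \<in> ?S m"
      then obtain a b where ab: "p = (a, b)" "a + b = m" by auto
      show "(case case p of (a, b) \<Rightarrow> (a + ?e, b) of (a, b) \<Rightarrow> (a - ?e, b)) = p" by (simp add: ab)
      show "(case p of (a, b) \<Rightarrow> (a + ?e, b)) \<in> {(a, b) \<in> ?S (m + ?e). Poly_Mapping.lookup a x \<noteq> 0}"
        using ab by (auto simp: Poly_Mapping.lookup_add ac_simps)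
    next
      fix p' assume "p' \<in> {(a, b) \<in> ?S (m + ?e). Poly_Mapping.lookup a x \<noteq> 0}"
      then obtain a b where ab: "p' = (a, b)" "Poly_Mapping.lookup a x \<noteq> 0" by auto
      have r: "a - ?e + ?e = a"
        by (rule poly_mapping_eqI)
          (use ab in \<open>auto simp: Poly_Mapping.lookup_add lookup_minus lookup_single when_def\<close>)
      have "Poly_Mapping.lookup (a - ?e) x + 1 = Poly_Mapping.lookup a x"
        using ab(2) by (simp add: lookup_minus)
      with r show "(case case p' of (a, b) \<Rightarrow> (a - ?e, b) of (a, b) \<Rightarrow>
          of_nat (Poly_Mapping.lookup a x + 1) * (p (a + ?e) * q b)) =
        (case p' of (a, b) \<Rightarrow> of_nat (Poly_Mapping.lookup a x) * (p a * q b))" by (simp only: ab prod.case)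
    qed
    finally show ?thesis .
  qed
  have swap: "(\<Sum>(a, b)\<in>?S k. h a b) = (\<Sum>(b, a)\<in>?S k. h a b)" for h :: "_ \<Rightarrow> _ \<Rightarrow> 'a" and k
    by (rule sum.reindex_bij_witness[of _ prod.swap prod.swap]) (auto simp: add.commute)
  have "scoeff (pderiv_series x (f * g)) m =
      (\<Sum>(a, b)\<in>?S (m + ?e). of_nat (Poly_Mapping.lookup (m + ?e) x) * (?F a * ?G b))"
    by (simp add: scoeff_pderiv_series scoeff_mult_nat to_int_nat_def sum_distrib_left split_def
        Poly_Mapping.lookup_add)
  also have "\<dots> = (\<Sum>(a, b)\<in>?S (m + ?e). of_nat (Poly_Mapping.lookup a x) * (?F a * ?G b)
      + of_nat (Poly_Mapping.lookup b x) * (?F a * ?G b))"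
  proof (rule sum.cong[OF refl])
    fix p assume "p \<in> ?S (m + ?e)"
    then obtain a b where p: "p = (a, b)" "m + ?e = a + b" by auto
    show "(case p of (a, b) \<Rightarrow> of_nat (Poly_Mapping.lookup (m + ?e) x) * (?F a * ?G b)) =
       (case p of (a, b) \<Rightarrow> of_nat (Poly_Mapping.lookup a x) * (?F a * ?G b)
      + of_nat (Poly_Mapping.lookup b x) * (?F a * ?G b))"
      unfolding p(2) by (simp add: p(1) Poly_Mapping.lookup_add distrib_right)
  qed
  also have "\<dots> = (\<Sum>(a, b)\<in>?S (m + ?e). of_nat (Poly_Mapping.lookup a x) * (?F a * ?G b))
      + (\<Sum>(b, a)\<in>?S (m + ?e). of_nat (Poly_Mapping.lookup b x) * (?F a * ?G b))"
    by (subst swap[of "\<lambda>b a. of_nat (Poly_Mapping.lookup b x) * (?F a * ?G b)"])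
       (simp add: sum.distrib split_def)
  also have "(\<Sum>(b, a)\<in>?S (m + ?e). of_nat (Poly_Mapping.lookup b x) * (?F a * ?G b)) =
      (\<Sum>(b, a)\<in>?S (m + ?e). of_nat (Poly_Mapping.lookup b x) * (?G b * ?F a))"
    by (simp add: mult.commute)
  also note shift
  also note shift
  also have "(\<Sum>(b, a)\<in>?S m. of_nat (Poly_Mapping.lookup b x + 1) * (?G (b + ?e) * ?F a)) =
      (\<Sum>(a, b)\<in>?S m. ?F a * (of_nat (Poly_Mapping.lookup b x + 1) * ?G (b + ?e)))"
    by (subst swap) (simp add: ac_simps)
  finally show "scoeff (pderiv_series x (f * g)) m =
      scoeff (pderiv_series x f * g + f * pderiv_series x g) m"
    by (simp add: scoeff_pderiv_series scoeff_mult_nat to_int_nat_def mult.assoc)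
qed

text \<open>The partial derivative by the coordinate \<open>p\<close>, extended to \<open>\<A>\<close> by the quotient rule.\<close>

definition loc_pderiv :: "'n coord \<Rightarrow> ('n::finite coord, real) pseries \<times> nat \<Rightarrow> ('n coord, real) pseries \<times> nat"
    where
  "loc_pderiv p = (\<lambda>(f, k). (pderiv_series p f * lin_det - of_nat k * f * pderiv_series p lin_det, Suc k))"

definition fdiff_pderiv :: "'n::finite coord \<Rightarrow> 'n fdiff_fun \<Rightarrow> 'n fdiff_fun" where
  "fdiff_pderiv p a = abs_fdiff_fun (loc_pderiv p (rep_fdiff_fun a))"

lemma pderiv_series_1: "pderiv_series x (1 :: ('v, 'a::comm_ring_1) pseries) = 0"
proof -
  have "pderiv_series x (1 * 1 :: ('v, 'a) pseries) = pderiv_series x 1 + pderiv_series x 1"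
    by (subst pderiv_series_mult) simp
  thus ?thesis by simp
qed

lemma pderiv_series_power:
  "pderiv_series x (f ^ k) * f = of_nat k * f ^ k * pderiv_series x (f :: ('v, 'a::comm_ring_1) pseries)"
proof (induction k)
  case (Suc k)
  have "pderiv_series x (f ^ Suc k) * f = pderiv_series x f * f ^ k * f + f * (pderiv_series x (f ^ k) * f)"
    by (simp add: pderiv_series_mult algebra_simps)
  also have "\<dots> = of_nat (Suc k) * f ^ Suc k * pderiv_series x f"
    unfolding Suc by (simp add: algebra_simps)
  finally show ?case .
qed (simp add: pderiv_series_1)

lemma loc_rel_pderiv:
  fixes q r :: "('n::finite coord, real) pseries \<times> nat"
  assumes "loc_rel q r" shows "loc_rel (loc_pderiv p q) (loc_pderiv p r)"
proof -
  obtain f k g l where q: "q = (f, k)" and r: "r = (g, l)" by (cases q; cases r)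
  let ?d = "lin_det :: ('n coord, real) pseries"
  let ?D = "pderiv_series p :: ('n coord, real) pseries \<Rightarrow> _"
  obtain m where "?d ^ m * (f * ?d ^ l) = ?d ^ m * (g * ?d ^ k)"
    using assms by (auto simp: loc_rel_def q r)
  hence m: "f * ?d ^ (m + l) = g * ?d ^ (m + k)" by (simp add: power_add algebra_simps)
  have D: "?D (h * ?d ^ n) * ?d = ?D h * ?d ^ n * ?d + of_nat n * (h * ?d ^ n) * ?D ?d" for h n
    using arg_cong[OF pderiv_series_power[of p ?d n], of "\<lambda>y. h * y"]
    by (simp add: pderiv_series_mult algebra_simps)
  have E: "(?D h * ?d - of_nat n * h * ?D ?d) * ?d ^ i =
      ?D (h * ?d ^ i) * ?d - of_nat (n + i) * (h * ?d ^ i) * ?D ?d" for h n i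
    unfolding D by (simp add: algebra_simps)
  have "(?D f * ?d - of_nat k * f * ?D ?d) * ?d ^ (m + l) = (?D g * ?d - of_nat l * g * ?D ?d) * ?d ^ (m + k)"
    unfolding E m by (simp add: algebra_simps)
  hence "?d ^ m * ((?D f * ?d - of_nat k * f * ?D ?d) * ?d ^ Suc l) =
      ?d ^ m * ((?D g * ?d - of_nat l * g * ?D ?d) * ?d ^ Suc k)"
    by (simp add: power_add ac_simps)
  thus ?thesis by (auto simp: loc_rel_def loc_pderiv_def q r intro!: exI[of _ m])
qed

lemma fdiff_pderiv_abs: "fdiff_pderiv p (abs_fdiff_fun q) = abs_fdiff_fun (loc_pderiv p q)"
proof -
  have "loc_rel (rep_fdiff_fun (abs_fdiff_fun q)) q"
    by (rule Quotient3_rep_abs[OF Quotient3_fdiff_fun]) (simp add: equivp_reflp[OF equivp_loc_rel])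
  thus ?thesis unfolding fdiff_pderiv_def using loc_rel_pderiv
    by (metis Quotient3_rel_abs[OF Quotient3_fdiff_fun])
qed


section \<open>The Poisson structure on the group\<close>

text \<open>
  \<open>X\<^sup>i(u) = \<Sum>\<^sub>I x\<^sup>i\<^sub>I u\<^sup>I\<close>, first with coefficients in \<open>R[[x]]\<close>, where the infinite sums that occur
  in compositions with \<open>X\<close> are formed, and then with coefficients in \<open>\<A>\<close>.
\<close>

definition coord_series :: "'n \<Rightarrow> ('n, ('n coord, real) pseries) pseries" where
  "coord_series i = Series (\<lambda>I. var (i, I))"

definition diffeo :: "'n::finite \<Rightarrow> ('n, 'n fdiff_fun) pseries" where
  "diffeo i = map_coeffs to_fdiff_fun (coord_series i)"

definition diffeo_jac :: "'n::finite \<Rightarrow> 'n \<Rightarrow> ('n, 'n fdiff_fun) pseries" where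
  "diffeo_jac i j = pderiv_series j (diffeo i)"

text \<open>\<open>f(X(u))\<close> and \<open>f(X(u), X(v))\<close>\<close>

definition compose_diffeo :: "('n::finite, real) pseries \<Rightarrow> ('n, 'n fdiff_fun) pseries" where
  "compose_diffeo f = map_coeffs to_fdiff_fun (subst_series coord_series f)"

definition compose_diffeo2 :: "('n::finite + 'n, real) pseries \<Rightarrow> ('n + 'n, 'n fdiff_fun) pseries" where
  "compose_diffeo2 f = map_coeffs to_fdiff_fun
     (subst_series (case_sum (\<lambda>i. rename Inl (coord_series i)) (\<lambda>i. rename Inr (coord_series i))) f)"

text \<open>A series with real coefficients, regarded as one with coefficients in \<open>\<A>\<close>.\<close>

abbreviation scalar_series :: "('v, real) pseries \<Rightarrow> ('v, 'n::finite fdiff_fun) pseries" where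
  "scalar_series \<equiv> map_coeffs (\<lambda>c. to_fdiff_fun (const c))"

definition Omega :: "('n::finite \<Rightarrow> 'n \<Rightarrow> ('n + 'n, real) pseries) \<Rightarrow> 'n \<Rightarrow> 'n
    \<Rightarrow> ('n + 'n, 'n fdiff_fun) pseries" where
  "Omega \<phi> i j = (\<Sum>k\<in>UNIV. \<Sum>l\<in>UNIV.
       rename Inl (diffeo_jac i k) * rename Inr (diffeo_jac j l) * scalar_series (\<phi> k l))
     - compose_diffeo2 (\<phi> i j)"

text \<open>
  The bracket on \<open>\<A>\<close> with \<open>{x\<^sup>i\<^sub>I, x\<^sup>j\<^sub>J}\<close> equal to the coefficient of \<open>u\<^sup>I v\<^sup>J\<close> in \<open>W\<^sup>i\<^sup>j\<close>, extended as a
  biderivation.  The sum over pairs of coordinates is finite if \<open>f\<close> and \<open>g\<close> depend on finitely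
  many coordinates only; there is no natural value for other \<open>f\<close> and \<open>g\<close> and \<open>Sum_any\<close> may
  give 0.
\<close>

definition fdiff_bracket :: "('n::finite \<Rightarrow> 'n \<Rightarrow> ('n + 'n, 'n fdiff_fun) pseries)
    \<Rightarrow> 'n fdiff_fun \<Rightarrow> 'n fdiff_fun \<Rightarrow> 'n fdiff_fun" where
  "fdiff_bracket W f g = Sum_any (\<lambda>((i, I), (j, J)).
     fdiff_pderiv (i, I) f * fdiff_pderiv (j, J) g *
       scoeff (W i j) (push_exponent Inl I + push_exponent Inr J))"

text \<open>\<open>{f(u), g(v)}\<close> for series \<open>f, g\<close> with coefficients in \<open>\<A>\<close>\<close>

definition series_bracket :: "('a::zero \<Rightarrow> 'a \<Rightarrow> 'a) \<Rightarrow> ('n, 'a) pseries \<Rightarrow> ('n, 'a) pseries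
    \<Rightarrow> ('n + 'n, 'a) pseries" where
  "series_bracket br f g =
     Series (\<lambda>m. br (scoeff f (Poly_Mapping.map_key Inl m)) (scoeff g (Poly_Mapping.map_key Inr m)))"

text \<open>
  The map \<open>(X, u) \<mapsto> X(u)\<close> is Poisson for the product of the bracket \<open>br\<close> on the group and of \<open>\<alpha>\<close>
  (checked on the coordinate functions of the target).
\<close>

definition poisson_action :: "('n::finite fdiff_fun \<Rightarrow> 'n fdiff_fun \<Rightarrow> 'n fdiff_fun)
    \<Rightarrow> ('n \<Rightarrow> 'n \<Rightarrow> ('n, real) pseries) \<Rightarrow> bool" where
  "poisson_action br \<alpha> \<longleftrightarrow> (\<forall>i j. compose_diffeo (\<alpha> i j) =
     diagonal (series_bracket br (diffeo i) (diffeo j)) +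
     (\<Sum>k\<in>UNIV. \<Sum>l\<in>UNIV. diffeo_jac i k * diffeo_jac j l * scalar_series (\<alpha> k l)))"

lemma abs_fdiff_fun_eqI: "loc_rel p q \<Longrightarrow> abs_fdiff_fun p = abs_fdiff_fun q"
  by (metis Quotient3_rel_abs[OF Quotient3_fdiff_fun])

lemma fdiff_pderiv_coord:
  "fdiff_pderiv p (to_fdiff_fun (var q)) = (if p = q then 1 else (0 :: 'n::finite fdiff_fun))"
proof -
  have single: "m + Poly_Mapping.single p 1 = Poly_Mapping.single q (1::nat) \<longleftrightarrow> m = 0 \<and> p = q"
    for m :: "'n coord \<Rightarrow>\<^sub>0 nat"
  proof
    assume e: "m + Poly_Mapping.single p 1 = Poly_Mapping.single q (1::nat)"
    have l: "Poly_Mapping.lookup m x + (if x = p then 1 else 0) = (if x = q then 1 else 0)" for x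
      using arg_cong[OF e, of "\<lambda>m. Poly_Mapping.lookup m x"]
      by (auto simp: Poly_Mapping.lookup_add lookup_single when_def split: if_splits)
    have "p = q" using l[of p] by (auto split: if_splits)
    moreover have "m = 0"
      by (rule poly_mapping_eqI) (use l \<open>p = q\<close> in \<open>auto split: if_splits\<close>)
    ultimately show "m = 0 \<and> p = q" by simp
  qed auto
  have "pderiv_series p (var q) = (if p = q then 1 else (0 :: ('n coord, real) pseries))"
    by (rule series_eqI) (auto simp: scoeff_pderiv_series scoeff_var single[unfolded One_nat_def] scoeff_1 to_int_nat_def)
  thus ?thesis
    by (auto simp: to_fdiff_fun_def fdiff_pderiv_abs loc_pderiv_def one_fdiff_fun_def zero_fdiff_fun_def
        intro!: abs_fdiff_fun_eqI loc_relI)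
qed

lemma push_exponent_map_key:
  fixes m :: "'n::finite + 'n \<Rightarrow>\<^sub>0 nat"
  shows "push_exponent Inl (Poly_Mapping.map_key Inl m) + push_exponent Inr (Poly_Mapping.map_key Inr m) = m"
proof (rule poly_mapping_eqI)
  fix x :: "'n + 'n"
  have [simp]: "{y. y = a} = {a}" for a :: 'n by auto
  show "Poly_Mapping.lookup (push_exponent Inl (Poly_Mapping.map_key Inl m) +
      push_exponent Inr (Poly_Mapping.map_key Inr m)) x = Poly_Mapping.lookup m x"
    by (cases x) (simp_all add: Poly_Mapping.lookup_add lookup_push_exponent map_key.rep_eq)
qed

lemma series_bracket_diffeo:
  fixes i j :: "'n::finite"
  shows "series_bracket (fdiff_bracket W) (diffeo i) (diffeo j) = W i j"
proof (rule series_eqI)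
  fix m :: "'n + 'n \<Rightarrow>\<^sub>0 nat"
  let ?p = "(i, Poly_Mapping.map_key Inl m)" and ?q = "(j, Poly_Mapping.map_key Inr m)"
  have "scoeff (series_bracket (fdiff_bracket W) (diffeo i) (diffeo j)) m =
      fdiff_bracket W (to_fdiff_fun (var ?p)) (to_fdiff_fun (var ?q))"
    by (simp add: series_bracket_def diffeo_def map_coeffs_def coord_series_def)
  also have "\<dots> = Sum_any (\<lambda>r. if r = (?p, ?q) then scoeff (W i j) m else 0)"
    unfolding fdiff_bracket_def
    by (rule arg_cong[of _ _ Sum_any]) (auto simp: fdiff_pderiv_coord push_exponent_map_key fun_eq_iff)
  also have "\<dots> = scoeff (W i j) m"
    by (subst Sum_any.expand_superset[of "{(?p, ?q)}"]) auto
  finally show "scoeff (series_bracket (fdiff_bracket W) (diffeo i) (diffeo j)) m = scoeff (W i j) m" .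
qed


section \<open>The bivector field and the solutions given by Laurent series\<close>

definition alpha :: "('n::finite \<Rightarrow> 'n \<Rightarrow> ('n + 'n, real) pseries) \<Rightarrow> 'n \<Rightarrow> 'n \<Rightarrow> ('n, real) pseries" where
  "alpha \<phi> i j = - diagonal (\<phi> i j)"

definition formal_jacobian :: "('n::finite \<Rightarrow> ('n, 'e::exponent, real) series) \<Rightarrow> ('n, 'e, real) series ^ 'n ^ 'n" where
  "formal_jacobian F = (\<chi> i j. pderiv_series j (F i))"

end

theory Submission
  imports Defs
begin

text \<open>
  Everything follows from restriction to the diagonal.  Identification of variables is a ring
  homomorphism of power or Laurent series (\<open>rename_mult\<close>), it is functorial (\<open>rename_comp\<close>) and
  satisfies the chain rule (\<open>pderiv_rename\<close>); in particular
  \<open>\<partial>\<^sub>s(f(u, u)) = (\<partial>\<^sub>1f)(u, u) + (\<partial>\<^sub>2f)(u, u)\<close>.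

  Setting \<open>u = v = w\<close> in the Yang-Baxter equation, and using the antisymmetry of \<open>\<phi>\<close> to pair its
  six terms, gives the Poisson condition for \<open>\<alpha>(u) = - \<phi>(u, u)\<close> (\<open>poisson_bivector_alpha\<close>).

  Setting \<open>u = v\<close> in \<open>\<Omega>\<close> gives the compatibility with the action.  The term \<open>\<phi>(X(u), X(v))\<close>
  must become \<open>- \<alpha>(X(u))\<close> (\<open>diagonal_compose_diffeo2\<close>), so identification of variables has to
  commute with substitution.  The constant coefficient of \<open>X(u)\<close> does not vanish but is a
  coordinate function \<open>x\<^sup>i\<^sub>0\<close>; hence a coefficient of the composite that has total degree \<open>d\<close> in the
  coordinates receives contributions only from the monomials of \<open>\<phi>\<close> of degree at most \<open>d\<close>
  (\<open>scoeff_subst_series\<close>), and all the sums to be exchanged are finite.  The bracket of the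
  coordinate functions \<open>X\<^sup>i(u)\<close> and \<open>X\<^sup>j(v)\<close> is \<open>\<Omega>\<^sup>i\<^sup>j\<close> itself, so that this identity also says that the
  action is Poisson.

  For the solutions given by Laurent series, the formula for \<open>\<alpha>\<close> is the image of the one for \<open>\<phi>\<close>
  under restriction to the diagonal, which commutes with the embedding of power series into
  Laurent series (\<open>rename_to_laurent\<close>).
\<close>

section \<open>Identification of variables as a ring homomorphism\<close>

lemma push_exponent_add: "push_exponent \<rho> (a + b) = push_exponent \<rho> a + push_exponent \<rho> b"
  by (rule poly_mapping_eqI) (simp add: lookup_push_exponent lookup_add sum.distrib)

lemma push_exponent_0 [simp]: "push_exponent \<rho> 0 = 0"
  by (rule poly_mapping_eqI) (simp add: lookup_push_exponent)

lemma push_exponent_single: "push_exponent \<rho> (Poly_Mapping.single y c) = Poly_Mapping.single (\<rho> y) c"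
  by (rule poly_mapping_eqI) (auto simp: lookup_push_exponent lookup_single when_def sum.If_cases)

lemma push_exponent_id [simp]: "push_exponent id m = m"
  by (rule poly_mapping_eqI) (simp add: lookup_push_exponent)

lemma push_exponent_comp:
  "push_exponent \<sigma> (push_exponent \<rho> m) = push_exponent (\<sigma> \<circ> \<rho>) m"
proof (rule poly_mapping_eqI)
  fix z
  have "Poly_Mapping.lookup (push_exponent \<sigma> (push_exponent \<rho> m)) z
      = (\<Sum>y | \<sigma> y = z. \<Sum>x | x \<in> {x. \<sigma> (\<rho> x) = z} \<and> \<rho> x = y. Poly_Mapping.lookup m x)"
    unfolding lookup_push_exponent by (intro sum.cong refl) auto
  also have "\<dots> = (\<Sum>x | \<sigma> (\<rho> x) = z. Poly_Mapping.lookup m x)"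
    by (rule sum.group) auto
  finally show "Poly_Mapping.lookup (push_exponent \<sigma> (push_exponent \<rho> m)) z
      = Poly_Mapping.lookup (push_exponent (\<sigma> \<circ> \<rho>) m) z"
    by (simp add: lookup_push_exponent)
qed

lemma scoeff_rename_superset:
  assumes "finite S" "{m. scoeff f m \<noteq> 0 \<and> push_exponent \<rho> m = k} \<subseteq> S"
    "\<And>m. m \<in> S \<Longrightarrow> push_exponent \<rho> m = k"
  shows "scoeff (rename \<rho> f) k = (\<Sum>m\<in>S. scoeff f m)"
  unfolding scoeff_rename by (rule sum.mono_neutral_left) (use assms in auto)

lemma finite_push_exponent_nat: "finite {m :: 'v::finite \<Rightarrow>\<^sub>0 nat. push_exponent \<rho> m = k}"
  using finite_push_exponent[of "Series (\<lambda>_. 1::nat) :: ('v, nat) pseries" \<rho> k] by simp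

lemma scoeff_rename_nat:
  fixes f :: "('v::finite, 'a::comm_monoid_add) pseries"
  shows "scoeff (rename \<rho> f) k = (\<Sum>m | push_exponent \<rho> m = k. scoeff f m)"
  by (rule scoeff_rename_superset) (auto simp: finite_push_exponent_nat)

lemma rename_0: "rename \<rho> 0 = 0"
  by (rule series_eqI) (simp add: scoeff_rename)

lemma rename_add:
  fixes f g :: "('v::finite, 'e::exponent, 'a::ab_group_add) series"
  shows "rename \<rho> (f + g) = rename \<rho> f + rename \<rho> g"
proof (rule series_eqI)
  fix k
  let ?S = "{m. scoeff f m \<noteq> 0 \<and> push_exponent \<rho> m = k} \<union> {m. scoeff g m \<noteq> 0 \<and> push_exponent \<rho> m = k}"
  have fin: "finite ?S" by (simp add: finite_push_exponent)
  have *: "scoeff (rename \<rho> h) k = (\<Sum>m\<in>?S. scoeff h m)"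
    if "{m. scoeff h m \<noteq> 0 \<and> push_exponent \<rho> m = k} \<subseteq> ?S" for h :: "('v, 'e, 'a) series"
    by (rule scoeff_rename_superset) (use that fin in auto)
  show "scoeff (rename \<rho> (f + g)) k = scoeff (rename \<rho> f + rename \<rho> g) k"
    by (subst scoeff_add, subst (1 2 3) *) (auto simp: sum.distrib)
qed

lemma rename_uminus:
  fixes f :: "('v::finite, 'e::exponent, 'a::ab_group_add) series"
  shows "rename \<rho> (- f) = - rename \<rho> f"
  by (rule series_eqI) (simp add: scoeff_rename sum_negf)

lemma rename_diff:
  fixes f g :: "('v::finite, 'e::exponent, 'a::ab_group_add) series"
  shows "rename \<rho> (f - g) = rename \<rho> f - rename \<rho> g"
  using rename_add[of \<rho> f "- g"] by (simp add: rename_uminus)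

lemma rename_sum:
  fixes f :: "'b \<Rightarrow> ('v::finite, 'e::exponent, 'a::ab_group_add) series"
  shows "rename \<rho> (\<Sum>i\<in>A. f i) = (\<Sum>i\<in>A. rename \<rho> (f i))"
  by (induction A rule: infinite_finite_induct) (simp_all add: rename_0 rename_add)

lemma rename_1: "rename \<rho> (1 :: ('v::finite, 'e::exponent, 'a::comm_ring_1) series) = 1"
proof (rule series_eqI)
  fix k
  have "{m :: 'v \<Rightarrow>\<^sub>0 'e. scoeff (1 :: ('v, 'e, 'a) series) m \<noteq> 0 \<and> push_exponent \<rho> m = k} = (if k = 0 then {0} else {})"
    by (auto simp: scoeff_1 split: if_splits)
  then show "scoeff (rename \<rho> (1 :: ('v, 'e, 'a) series)) k = scoeff 1 k"
    by (simp add: scoeff_rename scoeff_1)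
qed

text \<open>
  Both sides have coefficient \<open>\<Sum> f\<^sub>a g\<^sub>b\<close> at \<open>k\<close>, the sum being over all pairs of monomials of
  \<open>f\<close> and \<open>g\<close> with \<open>\<rho>(a) + \<rho>(b) = k\<close>.  There are finitely many such pairs because exponents are
  bounded below.
\<close>

lemma rename_mult:
  fixes f g :: "('v::finite, 'e::exponent, 'a::comm_ring_1) series" and \<rho> :: "'v \<Rightarrow> 'w"
  shows "rename \<rho> (f * g) = rename \<rho> f * rename \<rho> g"
proof (rule series_eqI)
  fix k :: "'w \<Rightarrow>\<^sub>0 'e"
  obtain N where N: "bounded_by N (scoeff f)" by (rule scoeff_bounded)
  obtain M where M: "bounded_by M (scoeff g)" by (rule scoeff_bounded)
  let ?p = "push_exponent \<rho>"
  let ?P = "splits (?p N) (?p M) k"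
  define T where "T = {(a, b). scoeff f a \<noteq> 0 \<and> scoeff g b \<noteq> 0 \<and> ?p (a + b) = k}"
  define h where "h = (\<lambda>(a, b). scoeff f a * scoeff g b)"
  have bnd: "bounded_by (?p L) (scoeff (rename \<rho> q))" if L: "bounded_by L (scoeff q)"
    for L and q :: "('v, 'e, 'a) series"
    unfolding bounded_by_def scoeff_rename
  proof safe
    fix c y assume "(\<Sum>m | scoeff q m \<noteq> 0 \<and> ?p m = c. scoeff q m) \<noteq> 0"
    from sum.not_neutral_contains_not_neutral[OF this]
    obtain m where m: "scoeff q m \<noteq> 0" "?p m = c" by blast
    show "Poly_Mapping.lookup (?p L) y \<le> to_int (Poly_Mapping.lookup c y)"
      unfolding m(2)[symmetric] lookup_push_exponent to_int_sum
      using L m(1) by (intro sum_mono) (auto simp: bounded_by_def)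
  qed
  have TP: "(\<lambda>(a, b). (?p a, ?p b)) ` T \<subseteq> ?P"
    using N M unfolding T_def splits_def bounded_by_def
    by (auto simp: push_exponent_add[symmetric] lookup_push_exponent to_int_sum intro!: sum_mono)
  \<comment> \<open>The sum over \<open>T\<close> grouped by \<open>(\<rho>(a), \<rho>(b))\<close> gives the product of the images, grouped by
    \<open>a + b\<close> it gives the image of the product.\<close>
  have fibre: "{x \<in> T. (case x of (a, b) \<Rightarrow> (?p a, ?p b)) = (A, B)}
      = {a. scoeff f a \<noteq> 0 \<and> ?p a = A} \<times> {b. scoeff g b \<noteq> 0 \<and> ?p b = B}"
    if "(A, B) \<in> ?P" for A B
    using that by (auto simp: T_def splits_def push_exponent_add)
  have finT: "finite T"
  proof -
    have "T = (\<Union>y\<in>?P. {x \<in> T. (case x of (a, b) \<Rightarrow> (?p a, ?p b)) = y})" using TP by auto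
    moreover have "finite {x \<in> T. (case x of (a, b) \<Rightarrow> (?p a, ?p b)) = y}" if "y \<in> ?P" for y
      using that by (cases y) (simp only: fibre finite_push_exponent finite_cartesian_product)
    ultimately show ?thesis by (metis (no_types, lifting) finite_UN_I finite_splits)
  qed
  have "scoeff (rename \<rho> f * rename \<rho> g) k
      = (\<Sum>y\<in>?P. \<Sum>x\<in>{x \<in> T. (case x of (a, b) \<Rightarrow> (?p a, ?p b)) = y}. h x)"
    unfolding scoeff_mult[OF bnd[OF N] bnd[OF M]]
    by (rule sum.cong[OF refl]) (clarsimp simp only: fibre scoeff_rename sum_product sum.cartesian_product h_def)
  also have "\<dots> = (\<Sum>x\<in>T. h x)" by (rule sum.group[OF finT _ TP]) simp
  finally have R: "scoeff (rename \<rho> f * rename \<rho> g) k = (\<Sum>x\<in>T. h x)" .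
  let ?U = "(\<lambda>(a, b). a + b) ` T"
  have prod: "scoeff (f * g) m = (\<Sum>x\<in>{x \<in> T. (case x of (a, b) \<Rightarrow> a + b) = m}. h x)" if "?p m = k" for m
  proof -
    have "scoeff (f * g) m = (\<Sum>(a, b) | a + b = m \<and> scoeff f a \<noteq> 0 \<and> scoeff g b \<noteq> 0. scoeff f a * scoeff g b)"
      unfolding scoeff_mult[OF N M] by (rule conv_splits[OF N M, symmetric])
    also have "\<dots> = (\<Sum>x\<in>{x \<in> T. (case x of (a, b) \<Rightarrow> a + b) = m}. h x)"
      by (rule sum.cong) (use that in \<open>auto simp: T_def h_def\<close>)
    finally show ?thesis .
  qed
  have "scoeff (rename \<rho> (f * g)) k = (\<Sum>m\<in>?U. scoeff (f * g) m)"
  proof (rule scoeff_rename_superset)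
    show "{m. scoeff (f * g) m \<noteq> 0 \<and> ?p m = k} \<subseteq> ?U"
    proof safe
      fix m assume m: "scoeff (f * g) m \<noteq> 0" "k = ?p m"
      from m(1) have "(\<Sum>x\<in>{x \<in> T. (case x of (a, b) \<Rightarrow> a + b) = m}. h x) \<noteq> 0"
        by (simp only: prod[OF m(2)[symmetric]] not_False_eq_True)
      from sum.not_neutral_contains_not_neutral[OF this]
      obtain x where "x \<in> T" "(case x of (a, b) \<Rightarrow> a + b) = m" by blast
      then show "m \<in> ?U" by (intro image_eqI[OF sym])
    qed
  qed (use finT in \<open>auto simp: T_def\<close>)
  also have "\<dots> = (\<Sum>m\<in>?U. \<Sum>x\<in>{x \<in> T. (case x of (a, b) \<Rightarrow> a + b) = m}. h x)"
    by (intro sum.cong refl prod) (auto simp: T_def)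
  also have "\<dots> = (\<Sum>x\<in>T. h x)" by (rule sum.group) (use finT in auto)
  finally show "scoeff (rename \<rho> (f * g)) k = scoeff (rename \<rho> f * rename \<rho> g) k" by (simp only: R)
qed

lemma rename_power:
  "rename \<rho> (f ^ n :: ('v::finite, 'e::exponent, 'a::comm_ring_1) series) = rename \<rho> f ^ n"
  by (induction n) (simp_all add: rename_1 rename_mult)

lemma rename_prod:
  fixes f :: "'b \<Rightarrow> ('v::finite, 'e::exponent, 'a::comm_ring_1) series"
  shows "rename \<rho> (\<Prod>i\<in>A. f i) = (\<Prod>i\<in>A. rename \<rho> (f i))"
  by (induction A rule: infinite_finite_induct) (simp_all add: rename_1 rename_mult)

lemma rename_id [simp]: "rename id f = f"
proof (rule series_eqI)
  fix k
  have "{m. scoeff f m \<noteq> 0 \<and> push_exponent id m = k} = (if scoeff f k = 0 then {} else {k})" by auto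
  then show "scoeff (rename id f) k = scoeff f k" by (simp add: scoeff_rename)
qed

lemma rename_comp:
  fixes f :: "('v::finite, 'e::exponent, 'a::comm_monoid_add) series" and \<rho> :: "'v \<Rightarrow> 'w::finite"
  shows "rename \<sigma> (rename \<rho> f) = rename (\<sigma> \<circ> \<rho>) f"
proof (rule series_eqI)
  fix k
  let ?S = "{m. scoeff f m \<noteq> 0 \<and> push_exponent (\<sigma> \<circ> \<rho>) m = k}"
  let ?U = "push_exponent \<rho> ` ?S"
  have fin: "finite ?S" by (rule finite_push_exponent)
  have coeff: "scoeff (rename \<rho> f) l = (\<Sum>m\<in>{m \<in> ?S. push_exponent \<rho> m = l}. scoeff f m)"
    if "push_exponent \<sigma> l = k" for l
    unfolding scoeff_rename by (rule sum.cong) (use that in \<open>auto simp: push_exponent_comp[symmetric]\<close>)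
  have "scoeff (rename \<sigma> (rename \<rho> f)) k = (\<Sum>l\<in>?U. scoeff (rename \<rho> f) l)"
  proof (rule scoeff_rename_superset)
    show "{l. scoeff (rename \<rho> f) l \<noteq> 0 \<and> push_exponent \<sigma> l = k} \<subseteq> ?U"
    proof safe
      fix l assume l: "scoeff (rename \<rho> f) l \<noteq> 0" "k = push_exponent \<sigma> l"
      from l(1) have "(\<Sum>m\<in>{m \<in> ?S. push_exponent \<rho> m = l}. scoeff f m) \<noteq> 0"
        by (simp only: coeff[OF l(2)[symmetric]] not_False_eq_True)
      from sum.not_neutral_contains_not_neutral[OF this]
      show "l \<in> push_exponent \<rho> ` {m. scoeff f m \<noteq> 0 \<and> push_exponent (\<sigma> \<circ> \<rho>) m = push_exponent \<sigma> l}"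
        using l(2) by blast
    qed
  qed (use fin in \<open>auto simp: push_exponent_comp\<close>)
  also have "\<dots> = (\<Sum>l\<in>?U. \<Sum>m\<in>{m \<in> ?S. push_exponent \<rho> m = l}. scoeff f m)"
    by (intro sum.cong refl coeff) (auto simp: push_exponent_comp)
  also have "\<dots> = (\<Sum>m\<in>?S. scoeff f m)" by (rule sum.group) (use fin in auto)
  finally show "scoeff (rename \<sigma> (rename \<rho> f)) k = scoeff (rename (\<sigma> \<circ> \<rho>) f) k"
    by (simp only: scoeff_rename[of "\<sigma> \<circ> \<rho>"])
qed

lemma diagonal_rename_Inl [simp]: "diagonal (rename Inl f) = f"
  by (simp add: rename_comp case_sum_o_inj)

lemma diagonal_rename_Inr [simp]: "diagonal (rename Inr f) = f"
  by (simp add: rename_comp case_sum_o_inj)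

lemma diagonal_at2_swap: "diagonal (at2 Inr Inl f) = diagonal f"
  by (simp add: rename_comp case_sum_o_inj o_case_sum)

text \<open>The chain rule for identification of variables.\<close>

lemma pderiv_rename:
  fixes f :: "('v::finite, 'a::comm_ring_1) pseries"
  shows "pderiv_series x (rename \<rho> f) = (\<Sum>y | \<rho> y = x. rename \<rho> (pderiv_series y f))"
proof (rule series_eqI)
  fix k
  let ?e = "\<lambda>y. Poly_Mapping.single y (1::nat)"
  let ?S = "{m. push_exponent \<rho> m = k + ?e x}"
  have shift: "(\<Sum>m | push_exponent \<rho> m = k. of_nat (Poly_Mapping.lookup m y + 1) * scoeff f (m + ?e y))
      = (\<Sum>m\<in>?S. of_nat (Poly_Mapping.lookup m y) * scoeff f m)" if y: "\<rho> y = x" for y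
  proof -
    have r: "m - ?e y + ?e y = m" if "Poly_Mapping.lookup m y \<noteq> 0" for m
      by (rule poly_mapping_eqI)
        (use that in \<open>auto simp: Poly_Mapping.lookup_add lookup_minus lookup_single when_def\<close>)
    have "(\<Sum>m\<in>?S. of_nat (Poly_Mapping.lookup m y) * scoeff f m)
        = (\<Sum>m\<in>{m \<in> ?S. Poly_Mapping.lookup m y \<noteq> 0}. of_nat (Poly_Mapping.lookup m y) * scoeff f m)"
      using finite_push_exponent_nat[of \<rho> "k + ?e x"] by (intro sum.mono_neutral_right) auto
    also have "\<dots> = (\<Sum>m | push_exponent \<rho> m = k. of_nat (Poly_Mapping.lookup m y + 1) * scoeff f (m + ?e y))"
    proof (rule sum.reindex_bij_witness[of _ "\<lambda>m. m + ?e y" "\<lambda>m. m - ?e y"])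
      fix m assume m: "m \<in> {m \<in> ?S. Poly_Mapping.lookup m y \<noteq> 0}"
      show m': "m - ?e y + ?e y = m" using m by (intro r) simp
      have "push_exponent \<rho> (m - ?e y + ?e y) = k + ?e x" using m unfolding m' by simp
      then show "m - ?e y \<in> {m. push_exponent \<rho> m = k}"
        by (simp add: push_exponent_add push_exponent_single y)
      have "Poly_Mapping.lookup (m - ?e y) y + 1 = Poly_Mapping.lookup m y"
        using m by (simp add: lookup_minus)
      then show "of_nat (Poly_Mapping.lookup (m - ?e y) y + 1) * scoeff f (m - ?e y + ?e y)
          = of_nat (Poly_Mapping.lookup m y) * scoeff f m" by (simp only: m')
    qed (auto simp: push_exponent_add push_exponent_single y Poly_Mapping.lookup_add)
    finally show ?thesis ..
  qed
  have weight: "(\<Sum>y | \<rho> y = x. of_nat (Poly_Mapping.lookup m y)) = (of_nat (Poly_Mapping.lookup k x + 1) :: 'a)"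
    if "m \<in> ?S" for m
  proof -
    have "(\<Sum>y | \<rho> y = x. Poly_Mapping.lookup m y) = Poly_Mapping.lookup (k + ?e x) x"
      using that by (simp flip: lookup_push_exponent)
    then have "(\<Sum>y | \<rho> y = x. Poly_Mapping.lookup m y) = Poly_Mapping.lookup k x + 1"
      by (simp add: Poly_Mapping.lookup_add)
    from arg_cong[OF this, of "of_nat :: nat \<Rightarrow> 'a"] show ?thesis by (simp only: of_nat_sum)
  qed
  have "scoeff (\<Sum>y | \<rho> y = x. rename \<rho> (pderiv_series y f)) k
      = (\<Sum>y | \<rho> y = x. \<Sum>m | push_exponent \<rho> m = k. of_nat (Poly_Mapping.lookup m y + 1) * scoeff f (m + ?e y))"
    by (simp add: scoeff_rename_nat scoeff_pderiv_series to_int_nat_def)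
  also have "\<dots> = (\<Sum>y | \<rho> y = x. \<Sum>m\<in>?S. of_nat (Poly_Mapping.lookup m y) * scoeff f m)"
    by (rule sum.cong[OF refl]) (rule shift, simp)
  also have "\<dots> = (\<Sum>m\<in>?S. (\<Sum>y | \<rho> y = x. of_nat (Poly_Mapping.lookup m y)) * scoeff f m)"
    by (subst sum.swap) (simp add: sum_distrib_right)
  also have "\<dots> = (\<Sum>m\<in>?S. of_nat (Poly_Mapping.lookup k x + 1) * scoeff f m)"
    by (rule sum.cong[OF refl]) (simp only: weight)
  also have "\<dots> = scoeff (pderiv_series x (rename \<rho> f)) k"
    by (simp add: scoeff_rename_nat scoeff_pderiv_series to_int_nat_def sum_distrib_left)
  finally show "scoeff (pderiv_series x (rename \<rho> f)) k
      = scoeff (\<Sum>y | \<rho> y = x. rename \<rho> (pderiv_series y f)) k" ..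
qed

lemma pderiv_rename_inj:
  fixes f :: "('v::finite, 'a::comm_ring_1) pseries"
  assumes "inj \<rho>"
  shows "pderiv_series (\<rho> y) (rename \<rho> f) = rename \<rho> (pderiv_series y f)"
proof -
  have "{z. \<rho> z = \<rho> y} = {y}" using assms by (auto dest: injD)
  then show ?thesis by (simp add: pderiv_rename)
qed

lemma pderiv_diagonal:
  fixes f :: "('n::finite + 'n, 'a::comm_ring_1) pseries"
  shows "pderiv_series s (diagonal f)
    = diagonal (pderiv_series (Inl s) f) + diagonal (pderiv_series (Inr s) f)"
proof -
  have "{y :: 'n + 'n. case_sum id id y = s} = {Inl s, Inr s}" by (auto simp: set_eq_iff split_sum_all)
  then show ?thesis by (simp add: pderiv_rename)
qed

lemma pderiv_at2_fst:
  fixes f :: "('n::finite + 'n, 'a::comm_ring_1) pseries"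
  assumes "inj (case_sum p q)"
  shows "pderiv_series (p s) (at2 p q f) = at2 p q (pderiv_series (Inl s) f)"
  using pderiv_rename_inj[OF assms, of "Inl s" f] by simp

lemma pderiv_series_uminus:
  "pderiv_series x (- f) = - pderiv_series x (f :: ('v, 'e::exponent, 'a::comm_ring_1) series)"
  by (rule series_eqI) (simp add: scoeff_pderiv_series)

section \<open>The bivector field on the diagonal\<close>

text \<open>
  On the diagonal \<open>u = v = w\<close> the six terms of the Yang-Baxter equation pair up: by antisymmetry
  \<open>\<partial>\<^sub>1\<phi>\<^sup>j\<^sup>i(u, u) = - \<partial>\<^sub>2\<phi>\<^sup>i\<^sup>j(u, u)\<close>, so the first two add up to
  \<open>\<phi>\<^sup>k\<^sup>s(u, u) (\<partial>\<^sub>1 + \<partial>\<^sub>2)\<phi>\<^sup>i\<^sup>j(u, u)\<close>, the first term of the Poisson condition.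
\<close>

lemma poisson_bivector_alpha:
  fixes \<phi> :: "'n::finite \<Rightarrow> 'n \<Rightarrow> ('n + 'n, real) pseries"
  assumes "cybe_solution \<phi>"
  shows "poisson_bivector (alpha \<phi>)"
proof -
  have anti: "\<phi> i j = - at2 Inr Inl (\<phi> j i)" for i j
    using assms unfolding cybe_solution_def by blast
  have cybe: "(\<Sum>s\<in>UNIV.
        at2 pw pu (\<phi> k s) * pderiv_series (pu s) (at2 pu pv (\<phi> i j))
      + at2 pv pw (\<phi> s k) * pderiv_series (pv s) (at2 pv pu (\<phi> j i))
      + at2 pu pv (\<phi> i s) * pderiv_series (pv s) (at2 pv pw (\<phi> j k))
      + at2 pw pu (\<phi> s i) * pderiv_series (pw s) (at2 pw pv (\<phi> k j))
      + at2 pv pw (\<phi> j s) * pderiv_series (pw s) (at2 pw pu (\<phi> k i))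
      + at2 pu pv (\<phi> s j) * pderiv_series (pu s) (at2 pu pw (\<phi> i k))
        :: ('n + 'n + 'n, real) pseries) = 0" for i j k
    using assms unfolding cybe_solution_def by blast
  define d where "d i j = diagonal (\<phi> i j)" for i j
  define D1 where "D1 s i j = diagonal (pderiv_series (Inl s) (\<phi> i j))" for s i j
  define D2 where "D2 s i j = diagonal (pderiv_series (Inr s) (\<phi> i j))" for s i j
  have d_anti: "d j i = - d i j" for i j
    unfolding d_def by (subst anti) (simp add: rename_uminus diagonal_at2_swap)
  have D1_anti: "D1 s j i = - D2 s i j" for s i j
  proof -
    have "inj (case_sum Inr Inl :: 'n + 'n \<Rightarrow> 'n + 'n)" by (auto simp: inj_def split: sum.splits)
    from pderiv_rename_inj[OF this, of "Inr s" "\<phi> i j"]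
    have "pderiv_series (Inl s) (at2 Inr Inl (\<phi> i j)) = at2 Inr Inl (pderiv_series (Inr s) (\<phi> i j))"
      by simp
    then show ?thesis
      unfolding D1_def D2_def
      by (subst anti) (simp add: pderiv_series_uminus rename_uminus diagonal_at2_swap)
  qed
  \<comment> \<open>\<open>\<delta>\<close> restricts to \<open>u = v = w\<close>.\<close>
  let ?\<delta> = "case_sum id (case_sum id id) :: 'n + 'n + 'n \<Rightarrow> 'n"
  have \<delta>: "rename ?\<delta> (at2 p q f) = diagonal f"
    if "?\<delta> \<circ> p = id" "?\<delta> \<circ> q = id" for p q and f :: "('n + 'n, real) pseries"
    by (simp only: rename_comp o_case_sum that)
  have inj: "inj (case_sum pu pv :: 'n + 'n \<Rightarrow> 'n + 'n + 'n)" "inj (case_sum pv pu :: 'n + 'n \<Rightarrow> 'n + 'n + 'n)"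
    "inj (case_sum pv pw :: 'n + 'n \<Rightarrow> 'n + 'n + 'n)" "inj (case_sum pw pv :: 'n + 'n \<Rightarrow> 'n + 'n + 'n)"
    "inj (case_sum pw pu :: 'n + 'n \<Rightarrow> 'n + 'n + 'n)" "inj (case_sum pu pw :: 'n + 'n \<Rightarrow> 'n + 'n + 'n)"
    by (auto simp: inj_def split: sum.splits)
  have comp: "?\<delta> \<circ> pu = id" "?\<delta> \<circ> pv = id" "?\<delta> \<circ> pw = id" by auto
  have dcybe: "(\<Sum>s\<in>UNIV. d k s * D1 s i j + d s k * D1 s j i + d i s * D1 s j k
      + d s i * D1 s k j + d j s * D1 s k i + d s j * D1 s i k) = 0" for i j k
    using arg_cong[OF cybe[of k i j], of "rename ?\<delta>"]
    unfolding pderiv_at2_fst[OF inj(1)] pderiv_at2_fst[OF inj(2)] pderiv_at2_fst[OF inj(3)]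
      pderiv_at2_fst[OF inj(4)] pderiv_at2_fst[OF inj(5)] pderiv_at2_fst[OF inj(6)]
      rename_sum rename_add rename_mult rename_0
    by (simp only: \<delta> comp d_def D1_def)
  have deriv: "pderiv_series s (alpha \<phi> i j) = - (D1 s i j + D2 s i j)" for s i j
    by (simp add: alpha_def pderiv_series_uminus pderiv_diagonal D1_def D2_def)
  have \<alpha>: "alpha \<phi> i j = - d i j" for i j by (simp add: alpha_def d_def)
  have "(\<Sum>s\<in>UNIV. alpha \<phi> k s * pderiv_series s (alpha \<phi> i j)
        + alpha \<phi> i s * pderiv_series s (alpha \<phi> j k) + alpha \<phi> j s * pderiv_series s (alpha \<phi> k i)) = 0"
    for i j k
  proof -
    have pair: "alpha \<phi> c s * pderiv_series s (alpha \<phi> a b) = d c s * D1 s a b + d s c * D1 s b a"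
      for s a b c
    proof -
      have "alpha \<phi> c s * pderiv_series s (alpha \<phi> a b) = d c s * (D1 s a b + D2 s a b)"
        unfolding deriv by (simp only: \<alpha> minus_mult_minus)
      also have "\<dots> = d c s * D1 s a b + d s c * D1 s b a"
        unfolding d_anti[of s c] D1_anti[of s b a] minus_mult_minus by (rule distrib_left)
      finally show ?thesis .
    qed
    show ?thesis using dcybe[of k i j] by (simp only: pair add.assoc)
  qed
  moreover have "alpha \<phi> i j = - alpha \<phi> j i" for i j
    unfolding \<alpha> by (subst d_anti) simp
  ultimately show ?thesis unfolding poisson_bivector_def by blast
qed

section \<open>Composition with a formal diffeomorphism\<close>

text \<open>
  The degree of a monomial in possibly infinitely many variables, a finite sum because the
  exponent vector has finite support.
\<close>

definition total_degree :: "('c \<Rightarrow>\<^sub>0 nat) \<Rightarrow> nat" where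
  "total_degree k = Sum_any (Poly_Mapping.lookup k)"

lemma total_degree_add: "total_degree (a + b) = total_degree a + total_degree b"
  unfolding total_degree_def lookup_add by (rule Sum_any.distrib) (rule finite_lookup)+

lemma total_degree_single [simp]: "total_degree (Poly_Mapping.single p c) = c"
  by (simp add: total_degree_def lookup_single)

lemma total_degree_finite: "total_degree (m :: 'v::finite \<Rightarrow>\<^sub>0 nat) = (\<Sum>x\<in>UNIV. Poly_Mapping.lookup m x)"
  unfolding total_degree_def by (rule Sum_any.expand_superset) auto

lemma total_degree_push_exponent:
  fixes m :: "'v::finite \<Rightarrow>\<^sub>0 nat" and \<sigma> :: "'v \<Rightarrow> 'w::finite"
  shows "total_degree (push_exponent \<sigma> m) = total_degree m"
  using sum.group[of "UNIV :: 'v set" "UNIV :: 'w set" \<sigma> "Poly_Mapping.lookup m"]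
  by (simp add: total_degree_finite lookup_push_exponent)

lemma finite_total_degree_le: "finite {m :: 'v::finite \<Rightarrow>\<^sub>0 nat. total_degree m \<le> d}"
proof (rule finite_subset)
  let ?B = "\<Sum>x\<in>UNIV. Poly_Mapping.single x (int d) :: 'v \<Rightarrow>\<^sub>0 int"
  let ?box = "{m :: 'v \<Rightarrow>\<^sub>0 nat. \<forall>x. Poly_Mapping.lookup 0 x \<le> to_int (Poly_Mapping.lookup m x) \<and>
      to_int (Poly_Mapping.lookup m x) \<le> Poly_Mapping.lookup ?B x}"
  show "finite ?box" by (rule finite_exponent_box)
  have B: "Poly_Mapping.lookup ?B x = int d" for x by (simp add: lookup_sum lookup_single when_def)
  have "Poly_Mapping.lookup m x \<le> total_degree m" for m :: "'v \<Rightarrow>\<^sub>0 nat" and x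
    unfolding total_degree_finite by (rule member_le_sum) auto
  then show "{m :: 'v \<Rightarrow>\<^sub>0 nat. total_degree m \<le> d} \<subseteq> ?box"
    unfolding B by (auto simp: to_int_nat_def intro: order_trans)
qed

text \<open>
  Every coefficient of \<open>F\<close>, itself a power series, has only monomials of total degree at least
  \<open>n\<close>.
\<close>

definition coeff_order_ge :: "nat \<Rightarrow> ('w, ('c, 'a::zero) pseries) pseries \<Rightarrow> bool" where
  "coeff_order_ge n F \<longleftrightarrow> (\<forall>K k. total_degree k < n \<longrightarrow> scoeff (scoeff F K) k = 0)"

lemma coeff_order_ge_0 [simp]: "coeff_order_ge 0 F"
  by (simp add: coeff_order_ge_def)

lemma coeff_order_ge_mult:
  fixes F G :: "('w, ('c, 'a::comm_ring_1) pseries) pseries"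
  assumes "coeff_order_ge a F" "coeff_order_ge b G"
  shows "coeff_order_ge (a + b) (F * G)"
  unfolding coeff_order_ge_def
proof safe
  fix K and k :: "'c \<Rightarrow>\<^sub>0 nat" assume k: "total_degree k < a + b"
  have z: "scoeff (scoeff F A) p * scoeff (scoeff G B) q = 0" if "p + q = k" for A B p q
  proof -
    have "total_degree p + total_degree q < a + b" using k that by (metis total_degree_add)
    then have "total_degree p < a \<or> total_degree q < b" by linarith
    then show ?thesis using assms by (auto simp: coeff_order_ge_def)
  qed
  show "scoeff (scoeff (F * G) K) k = 0"
    by (auto simp: scoeff_mult_nat z intro!: sum.neutral)
qed

lemma coeff_order_ge_power:
  fixes F :: "('w, ('c, 'a::comm_ring_1) pseries) pseries"
  assumes "coeff_order_ge 1 F"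
  shows "coeff_order_ge n (F ^ n)"
proof (induction n)
  case (Suc n)
  show ?case using coeff_order_ge_mult[OF assms Suc.IH] by simp
qed simp

lemma coeff_order_ge_prod:
  fixes F :: "'i \<Rightarrow> ('w, ('c, 'a::comm_ring_1) pseries) pseries"
  assumes "\<And>i. coeff_order_ge (n i) (F i)"
  shows "coeff_order_ge (\<Sum>i\<in>A. n i) (\<Prod>i\<in>A. F i)"
proof (induction A rule: infinite_finite_induct)
  case (insert x A)
  then show ?case using coeff_order_ge_mult[OF assms] by simp
qed simp_all

lemma coeff_order_ge_rename:
  fixes F :: "('v::finite, ('c, 'a::comm_ring_1) pseries) pseries"
  assumes "coeff_order_ge n F"
  shows "coeff_order_ge n (rename \<rho> F)"
  using assms by (simp add: coeff_order_ge_def scoeff_rename_nat)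

text \<open>
  Substituted series of positive order contribute to a coefficient of total degree \<open>d\<close> only
  through the monomials of total degree at most \<open>d\<close>.
\<close>

lemma scoeff_subst_series:
  fixes g :: "'v::finite \<Rightarrow> ('w, ('c, 'a::comm_ring_1) pseries) pseries"
  assumes "\<And>x. coeff_order_ge 1 (g x)"
  shows "scoeff (scoeff (subst_series g f) K) k = (\<Sum>m | total_degree m \<le> total_degree k.
     scoeff f m * scoeff (scoeff (\<Prod>x\<in>UNIV. g x ^ Poly_Mapping.lookup m x) K) k)"
proof -
  have "coeff_order_ge (total_degree m) (\<Prod>x\<in>UNIV. g x ^ Poly_Mapping.lookup m x)" for m
    unfolding total_degree_finite by (intro coeff_order_ge_prod coeff_order_ge_power assms)
  then have "scoeff (scoeff (\<Prod>x\<in>UNIV. g x ^ Poly_Mapping.lookup m x) K) k = 0"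
    if "\<not> total_degree m \<le> total_degree k" for m
    using that by (simp add: coeff_order_ge_def)
  then show ?thesis
    unfolding subst_series_def scoeff_Series_nat
    by (intro Sum_any.expand_superset finite_total_degree_le) (auto intro: ccontr)
qed

lemma rename_subst_series:
  fixes g :: "'v::finite \<Rightarrow> ('w::finite, ('c, 'a::comm_ring_1) pseries) pseries"
  assumes g: "\<And>x. coeff_order_ge 1 (g x)"
  shows "rename \<rho> (subst_series g f) = subst_series (\<lambda>x. rename \<rho> (g x)) f"
proof (rule series_eqI, rule series_eqI)
  fix K and k :: "'c \<Rightarrow>\<^sub>0 nat"
  let ?B = "{m :: 'v \<Rightarrow>\<^sub>0 nat. total_degree m \<le> total_degree k}"
  let ?c = "\<lambda>m. \<Prod>x\<in>UNIV. g x ^ Poly_Mapping.lookup m x"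
  have "scoeff (scoeff (rename \<rho> (subst_series g f)) K) k
      = (\<Sum>L | push_exponent \<rho> L = K. \<Sum>m\<in>?B. scoeff f m * scoeff (scoeff (?c m) L) k)"
    by (simp add: scoeff_rename_nat scoeff_subst_series[OF g])
  also have "\<dots> = (\<Sum>m\<in>?B. scoeff f m * (\<Sum>L | push_exponent \<rho> L = K. scoeff (scoeff (?c m) L) k))"
    by (subst sum.swap) (simp add: sum_distrib_left)
  also have "\<dots> = (\<Sum>m\<in>?B. scoeff f m * scoeff (scoeff (rename \<rho> (?c m)) K) k)"
    by (simp add: scoeff_rename_nat)
  also have "\<dots> = scoeff (scoeff (subst_series (\<lambda>x. rename \<rho> (g x)) f) K) k"
    by (simp add: scoeff_subst_series[OF coeff_order_ge_rename[OF g]] rename_prod rename_power)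
  finally show "scoeff (scoeff (rename \<rho> (subst_series g f)) K) k
      = scoeff (scoeff (subst_series (\<lambda>x. rename \<rho> (g x)) f) K) k" .
qed

lemma subst_series_rename:
  fixes g :: "'u::finite \<Rightarrow> ('w, ('c, 'a::comm_ring_1) pseries) pseries" and \<sigma> :: "'v::finite \<Rightarrow> 'u"
  assumes g: "\<And>x. coeff_order_ge 1 (g x)"
  shows "subst_series g (rename \<sigma> f) = subst_series (g \<circ> \<sigma>) f"
proof (rule series_eqI, rule series_eqI)
  fix K and k :: "'c \<Rightarrow>\<^sub>0 nat"
  let ?B = "{m :: 'u \<Rightarrow>\<^sub>0 nat. total_degree m \<le> total_degree k}"
  let ?B' = "{m :: 'v \<Rightarrow>\<^sub>0 nat. total_degree m \<le> total_degree k}"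
  let ?c = "\<lambda>m. \<Prod>x\<in>UNIV. g x ^ Poly_Mapping.lookup m x"
  let ?h = "\<lambda>m. scoeff f m * scoeff (scoeff (?c (push_exponent \<sigma> m)) K) k"
  have g': "coeff_order_ge 1 ((g \<circ> \<sigma>) y)" for y
    using g by (simp only: o_apply)
  have monom: "?c (push_exponent \<sigma> m) = (\<Prod>y\<in>UNIV. (g \<circ> \<sigma>) y ^ Poly_Mapping.lookup m y)" for m
  proof -
    have "?c (push_exponent \<sigma> m)
        = (\<Prod>x\<in>UNIV. \<Prod>y\<in>{y \<in> UNIV. \<sigma> y = x}. (g \<circ> \<sigma>) y ^ Poly_Mapping.lookup m y)"
      by (simp add: lookup_push_exponent power_sum)
    also have "\<dots> = (\<Prod>y\<in>UNIV. (g \<circ> \<sigma>) y ^ Poly_Mapping.lookup m y)"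
      by (rule prod.group) auto
    finally show ?thesis .
  qed
  have "scoeff (scoeff (subst_series g (rename \<sigma> f)) K) k
      = (\<Sum>m\<in>?B. \<Sum>l\<in>{l \<in> ?B'. push_exponent \<sigma> l = m}. ?h l)"
    unfolding scoeff_subst_series[OF g] scoeff_rename_nat sum_distrib_right
    by (intro sum.cong refl) (auto simp: total_degree_push_exponent)
  also have "\<dots> = (\<Sum>l\<in>?B'. ?h l)"
    by (rule sum.group) (auto simp: finite_total_degree_le total_degree_push_exponent)
  also have "\<dots> = scoeff (scoeff (subst_series (g \<circ> \<sigma>) f) K) k"
    by (simp only: scoeff_subst_series[OF g'] monom)
  finally show "scoeff (scoeff (subst_series g (rename \<sigma> f)) K) k
      = scoeff (scoeff (subst_series (g \<circ> \<sigma>) f) K) k" .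
qed

lemma subst_series_uminus:
  fixes g :: "'v::finite \<Rightarrow> ('w, ('c, 'a::comm_ring_1) pseries) pseries"
  assumes g: "\<And>x. coeff_order_ge 1 (g x)"
  shows "subst_series g (- f) = - subst_series g f"
  by (rule series_eqI, rule series_eqI) (simp add: scoeff_subst_series[OF g] sum_negf)

lemma coeff_order_ge_coord_series: "coeff_order_ge 1 (coord_series i)"
  by (auto simp: coeff_order_ge_def coord_series_def scoeff_var)

lemma rename_map_coeffs:
  fixes h :: "'a::comm_monoid_add \<Rightarrow> 'b::comm_monoid_add" and f :: "('v::finite, 'a) pseries"
  assumes "h 0 = 0" "\<And>x y. h (x + y) = h x + h y"
  shows "rename \<rho> (map_coeffs h f) = map_coeffs h (rename \<rho> f)"
proof (rule series_eqI)
  fix k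
  have "h (sum a S) = (\<Sum>i\<in>S. h (a i))" for a :: "('v \<Rightarrow>\<^sub>0 nat) \<Rightarrow> 'a" and S
    by (induction S rule: infinite_finite_induct) (simp_all add: assms)
  then show "scoeff (rename \<rho> (map_coeffs h f)) k = scoeff (map_coeffs h (rename \<rho> f)) k"
    by (simp add: scoeff_rename_nat map_coeffs_def)
qed

lemma map_coeffs_uminus:
  fixes h :: "'a::ab_group_add \<Rightarrow> 'b::ab_group_add"
  assumes "\<And>x y. h (x + y) = h x + h y"
  shows "map_coeffs h (- f) = - map_coeffs h f"
proof (rule series_eqI)
  fix k
  interpret additive h by standard (rule assms)
  show "scoeff (map_coeffs h (- f)) k = scoeff (- map_coeffs h f) k"
    by (simp add: map_coeffs_def minus)
qed

lemma to_fdiff_fun_0: "to_fdiff_fun 0 = 0"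
  by (simp add: to_fdiff_fun_def zero_fdiff_fun_def)

lemma to_fdiff_fun_add: "to_fdiff_fun (f + g) = to_fdiff_fun f + to_fdiff_fun g"
  by (simp add: to_fdiff_fun_def plus_fdiff_fun.abs_eq equivp_reflp[OF equivp_loc_rel])

lemma const_0: "const 0 = (0 :: ('v, 'a::zero) pseries)"
  by (rule series_eqI) (simp add: scoeff_const)

lemma const_add: "const (a + b) = (const a + const b :: ('v, 'a::ab_group_add) pseries)"
  by (rule series_eqI) (simp add: scoeff_const)

lemma compose_diffeo_uminus: "compose_diffeo (- f) = - compose_diffeo f"
  unfolding compose_diffeo_def
  by (simp add: subst_series_uminus[OF coeff_order_ge_coord_series] map_coeffs_uminus to_fdiff_fun_add)

text \<open>The restriction of \<open>f(X(u), X(v))\<close> to \<open>u = v\<close> is the restriction of \<open>f\<close> to the diagonal, at \<open>X(u)\<close>.\<close>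

lemma diagonal_compose_diffeo2: "diagonal (compose_diffeo2 f) = compose_diffeo (diagonal f)"
proof -
  let ?g = "case_sum (\<lambda>i. rename Inl (coord_series i)) (\<lambda>i. rename Inr (coord_series i))
    :: 'a + 'a \<Rightarrow> ('a + 'a, ('a coord, real) pseries) pseries"
  have g: "coeff_order_ge 1 (?g x)" for x
    by (cases x) (simp_all only: sum.case coeff_order_ge_rename coeff_order_ge_coord_series)
  have "(\<lambda>x. diagonal (?g x)) = coord_series \<circ> case_sum id id"
    by (auto simp: fun_eq_iff split: sum.split)
  then have "diagonal (subst_series ?g f) = subst_series coord_series (diagonal f)"
    by (simp add: rename_subst_series[OF g] subst_series_rename[OF coeff_order_ge_coord_series])
  then show ?thesis
    unfolding compose_diffeo_def compose_diffeo2_def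
    by (simp add: rename_map_coeffs to_fdiff_fun_0 to_fdiff_fun_add)
qed

text \<open>
  The compatibility with the action: restricting \<open>\<Omega>\<close> to \<open>u = v\<close> turns its two terms into the
  transformed bivector field and the bivector field at \<open>X(u)\<close>, with signs from
  \<open>\<alpha>(u) = - \<phi>(u, u)\<close>.
\<close>

lemma compose_diffeo_alpha:
  fixes \<phi> :: "'n::finite \<Rightarrow> 'n \<Rightarrow> ('n + 'n, real) pseries"
  shows "compose_diffeo (alpha \<phi> i j) = diagonal (Omega \<phi> i j) +
         (\<Sum>k\<in>UNIV. \<Sum>l\<in>UNIV. diffeo_jac i k * diffeo_jac j l * scalar_series (alpha \<phi> k l))"
proof -
  let ?h = "\<lambda>c. to_fdiff_fun (const c) :: 'n fdiff_fun"
  have add: "to_fdiff_fun (const (x + y)) = (to_fdiff_fun (const x) + to_fdiff_fun (const y) :: 'n fdiff_fun)"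
    for x y :: real
    by (simp add: const_add to_fdiff_fun_add)
  have scalar: "(scalar_series (alpha \<phi> k l) :: ('n, 'n fdiff_fun) pseries)
      = - diagonal (scalar_series (\<phi> k l))" for k l
    unfolding alpha_def
    by (simp add: map_coeffs_uminus[where h = ?h, OF add] rename_map_coeffs[where h = ?h, OF _ add] const_0 to_fdiff_fun_0)
  have "diagonal (Omega \<phi> i j) = (\<Sum>k\<in>UNIV. \<Sum>l\<in>UNIV.
      diffeo_jac i k * diffeo_jac j l * diagonal (scalar_series (\<phi> k l))) + compose_diffeo (alpha \<phi> i j)"
    by (simp add: Omega_def rename_diff rename_sum rename_mult diagonal_compose_diffeo2 alpha_def
        compose_diffeo_uminus)
  then show ?thesis by (simp add: scalar sum_negf)
qed

section \<open>Laurent series\<close>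

lemma to_laurent_uminus: "to_laurent (- f) = - to_laurent (f :: ('v, 'a::ab_group_add) pseries)"
  by (rule series_eqI) (simp add: scoeff_to_laurent)

lemma rename_to_laurent:
  fixes f :: "('v::finite, 'a::comm_monoid_add) pseries" and \<rho> :: "'v \<Rightarrow> 'w"
  shows "rename \<rho> (to_laurent f) = to_laurent (rename \<rho> f)"
proof (rule series_eqI)
  fix k :: "'w \<Rightarrow>\<^sub>0 int"
  let ?nat = "Poly_Mapping.map nat :: ('v \<Rightarrow>\<^sub>0 int) \<Rightarrow> ('v \<Rightarrow>\<^sub>0 nat)"
  let ?int = "Poly_Mapping.map int :: ('v \<Rightarrow>\<^sub>0 nat) \<Rightarrow> ('v \<Rightarrow>\<^sub>0 int)"
  let ?nat' = "Poly_Mapping.map nat :: ('w \<Rightarrow>\<^sub>0 int) \<Rightarrow> ('w \<Rightarrow>\<^sub>0 nat)"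
  have look [simp]: "Poly_Mapping.lookup (Poly_Mapping.map nat m) x = nat (Poly_Mapping.lookup m x)"
    for m :: "'x \<Rightarrow>\<^sub>0 int" and x
    by (simp add: map.rep_eq when_def)
  have look' [simp]: "Poly_Mapping.lookup (?int m) x = int (Poly_Mapping.lookup m x)" for m x
    by (simp add: map.rep_eq when_def)
  define S where "S = {m :: 'v \<Rightarrow>\<^sub>0 int. (\<forall>x. 0 \<le> Poly_Mapping.lookup m x) \<and> push_exponent \<rho> m = k}"
  have nat_int: "?nat (?int m) = m" for m by (rule poly_mapping_eqI) simp
  have int_nat: "?int (?nat m) = m" if "\<forall>x. 0 \<le> Poly_Mapping.lookup m x" for m
    by (rule poly_mapping_eqI) (use that in simp)
  show "scoeff (rename \<rho> (to_laurent f)) k = scoeff (to_laurent (rename \<rho> f)) k"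
  proof (cases "\<forall>x. 0 \<le> Poly_Mapping.lookup k x")
    case True
    let ?T = "{m. push_exponent \<rho> m = ?nat' k}"
    have int_push: "int (Poly_Mapping.lookup (push_exponent \<rho> m) y) = Poly_Mapping.lookup (push_exponent \<rho> (?int m)) y"
      for m y by (simp add: lookup_push_exponent)
    \<comment> \<open>For nonnegative \<open>k\<close> the monomials of \<open>to_laurent f\<close> over \<open>k\<close> are those of \<open>f\<close> over \<open>k\<close>.\<close>
    have T: "push_exponent \<rho> m = ?nat' k \<longleftrightarrow> push_exponent \<rho> (?int m) = k" for m
    proof
      assume e: "push_exponent \<rho> m = ?nat' k"
      show "push_exponent \<rho> (?int m) = k"
        by (rule poly_mapping_eqI) (use True in \<open>simp flip: int_push add: e\<close>)
    next
      assume e: "push_exponent \<rho> (?int m) = k"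
      show "push_exponent \<rho> m = ?nat' k"
        by (rule poly_mapping_eqI) (simp flip: e int_push)
    qed
    have S: "S = ?int ` ?T"
    proof safe
      fix m assume "m \<in> S"
      then have m: "\<forall>x. 0 \<le> Poly_Mapping.lookup m x" "push_exponent \<rho> m = k" by (auto simp: S_def)
      show "m \<in> ?int ` ?T"
        by (rule image_eqI[of _ _ "?nat m"]) (simp_all add: int_nat[OF m(1)] T m(2))
    qed (simp add: S_def T)
    have "scoeff (rename \<rho> (to_laurent f)) k = (\<Sum>m\<in>S. scoeff (to_laurent f) m)"
    proof (rule scoeff_rename_superset)
      show "finite S" unfolding S by (intro finite_imageI finite_push_exponent_nat)
    qed (auto simp: S_def scoeff_to_laurent split: if_splits)
    also have "\<dots> = (\<Sum>m\<in>?T. scoeff (to_laurent f) (?int m))"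
      unfolding S by (rule sum.reindex_cong[OF _ refl refl]) (metis inj_onI nat_int)
    also have "\<dots> = (\<Sum>m\<in>?T. scoeff f m)" by (simp add: scoeff_to_laurent nat_int)
    finally show ?thesis using True by (simp add: scoeff_to_laurent scoeff_rename_nat)
  next
    case False
    then have "{m. scoeff (to_laurent f) m \<noteq> 0 \<and> push_exponent \<rho> m = k} = {}"
      by (auto simp: scoeff_to_laurent lookup_push_exponent intro!: sum_nonneg split: if_splits)
    then show ?thesis using False by (simp only: scoeff_rename scoeff_to_laurent sum.empty if_False)
  qed
qed

section \<open>The induced Poisson structure\<close>

theorem proposition4p1:
  fixes \<phi> :: "'n::finite \<Rightarrow> 'n \<Rightarrow> ('n + 'n, real) pseries"
  assumes "cybe_solution \<phi>"
  shows "poisson_bivector (alpha \<phi>)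
    \<and> poisson_action (fdiff_bracket (Omega \<phi>)) (alpha \<phi>)
    \<and> (\<forall>i j. compose_diffeo (alpha \<phi> i j) = diagonal (Omega \<phi> i j) +
         (\<Sum>k\<in>UNIV. \<Sum>l\<in>UNIV. diffeo_jac i k * diffeo_jac j l * scalar_series (alpha \<phi> k l)))
    \<and> (\<forall>F :: 'n \<Rightarrow> ('n, real) lseries.
         invertible (formal_jacobian F) \<longrightarrow>
         (\<forall>i j. to_laurent (\<phi> i j) = (\<Sum>k\<in>UNIV. \<Sum>l\<in>UNIV.
            rename Inl (matrix_inv (formal_jacobian F) $ i $ k) * rename Inr (matrix_inv (formal_jacobian F) $ j $ l) *
            (rename Inl (F k) - rename Inr (F l)))) \<longrightarrow>
         (\<forall>i j. to_laurent (alpha \<phi> i j) = - diagonal (to_laurent (\<phi> i j)) \<and>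
            - diagonal (to_laurent (\<phi> i j)) = - (\<Sum>k\<in>UNIV. \<Sum>l\<in>UNIV.
              matrix_inv (formal_jacobian F) $ i $ k * matrix_inv (formal_jacobian F) $ j $ l * (F k - F l))))"
proof (intro conjI allI impI)
  show "poisson_bivector (alpha \<phi>)" using assms by (rule poisson_bivector_alpha)
  show "poisson_action (fdiff_bracket (Omega \<phi>)) (alpha \<phi>)"
    unfolding poisson_action_def series_bracket_diffeo using compose_diffeo_alpha by blast
next
  fix i j :: 'n
  show "compose_diffeo (alpha \<phi> i j) = diagonal (Omega \<phi> i j) +
      (\<Sum>k\<in>UNIV. \<Sum>l\<in>UNIV. diffeo_jac i k * diffeo_jac j l * scalar_series (alpha \<phi> k l))"
    by (rule compose_diffeo_alpha)
  show "to_laurent (alpha \<phi> i j) = - diagonal (to_laurent (\<phi> i j))"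
    by (simp add: alpha_def to_laurent_uminus rename_to_laurent)
next
  fix F :: "'n \<Rightarrow> ('n, real) lseries" and i j :: 'n
  let ?J = "matrix_inv (formal_jacobian F)"
  assume "\<forall>i j. to_laurent (\<phi> i j) = (\<Sum>k\<in>UNIV. \<Sum>l\<in>UNIV.
      rename Inl (?J $ i $ k) * rename Inr (?J $ j $ l) * (rename Inl (F k) - rename Inr (F l)))"
  then show "- diagonal (to_laurent (\<phi> i j)) = - (\<Sum>k\<in>UNIV. \<Sum>l\<in>UNIV.
      ?J $ i $ k * ?J $ j $ l * (F k - F l))"
    by (simp add: rename_sum rename_mult rename_diff)
qed

end
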